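(* Let $\mathcal R^q:\mathcal A^{\mathbb N}\to\mathcal A^{\mathbb N}$ be the $\mathcal A$-linear map $P\mapsto\hat P$ given, for $\alpha\ge0$, $\beta\ge1$ and with $p_{-1}^q=p_{-1}^m=0$, by $$\hat p_0=u_xp_0+p_1^r,\quad \hat p_\alpha^q=q_{\alpha,x}p_0+p_{\alpha-1}^q,\quad \hat p_\alpha^m=m_{\alpha,x}p_0-\frac1t\,p_{\alpha-1}^m-\frac zt\,p_\alpha^m,\quad \hat p_\beta^r=r_{\beta,x}p_0-p_{\beta+1}^r,$$ and let $\mathcal I$ be the identity mapping on $\mathcal A^{\mathbb N}$. Then the $\mathcal A$-linear mapping $\mathcal R^m:\mathcal A^{\mathbb N}\to\mathcal A^{\mathbb N}$ defined by $$\mathcal R^m=t\,\mathcal R^q+z\,\mathcal I$$ is a recursion operator for $\tau^W$-symmetries of the reduced quasi-classical self-dual Yang-Mills equation $\mathcal E$: $u_{yz}=u_{tx}-u_zu_{xx}+u_xu_{xz}$; that is, $\mathcal R^m(P)\in\mathrm{sym}_{\mathcal A}^{\tau^W}(\mathcal E)$ whenever $P\in\mathrm{sym}_{\mathcal A}^{\tau^W}(\mathcal E)$.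
   Context: A recursion operator for $\tau^W$-symmetries is an $\mathbb R$-linear map $\mathcal A^{\mathbb N}\to\mathcal A^{\mathbb N}$ that maps $\mathrm{sym}_{\mathcal A}^{\tau^W}(\mathcal E)$ into itself. **The space $\tilde{\mathcal E}^W$.** Its (internal) coordinates are: $x,y,z,t$; $u_{x^it^j}$ ($i,j\ge0$), $u_{x^iy^kt^j}$ and $u_{x^iz^lt^j}$ ($i,j\ge 0$, $k,l\ge1$); $q_\alpha^{a,b}$, $m_\alpha^{a,b}$ ($\alpha,a,b\ge0$); $r_\beta^{a,b}$ ($\beta\ge1$, $a,b\ge0$). Write $u=u_{x^0t^0}$, $q_\alpha=q_\alpha^{0,0}$, $m_\alpha=m_\alpha^{0,0}$, $r_\beta=r_\beta^{0,0}$, and set $r_0=-u$, $q_{-1}^{a,b}=m_{-1}^{a,b}=0$. Every function considered depends on finitely many of these coordinates. **The algebra $\mathcal A$.** $\mathcal A$ is the commutative $\mathbb R$-algebra generated by $\mathcal L\cup\mathcal F$, where $\mathcal F$ is the algebra of smooth functions of (finitely many of) the internal coordinates on $\tilde{\mathcal E}^W$ and $\mathcal L$ is the algebra of Laurent polynomials with real coefficients in (finitely many of) the internal coordinates. Elements of $\mathcal A$ are smooth functions defined where the finitely many inverted coordinates are nonzero, two being identified if they agree on such a common dense open set. $\mathcal A^{\mathbb N}$ is the $\mathcal A$-module of all sequences of elements of $\mathcal A$, written $P=[p_0,p_0^q,p_0^m,p_1^r,p_1^q,p_1^m,p_2^r,p_2^q,p_2^m,\ldots]$. **Total derivatives.**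 $\tilde D_x,\tilde D_y,\tilde D_z,\tilde D_t$ are the derivations (vector fields) on functions on $\tilde{\mathcal E}^W$ acting on $x,y,z,t$ as the corresponding partial derivatives and on the other coordinates as follows. Put $G=u_{tx}-u_zu_{xx}+u_xu_{xz}$. - $\tilde D_x$ and $\tilde D_t$ raise $i$, resp. $j$, by one in every $u$-coordinate. - $\tilde D_y u_{x^it^j}=u_{x^iyt^j}$, $\tilde D_yu_{x^iy^kt^j}=u_{x^iy^{k+1}t^j}$, $\tilde D_yu_{x^iz^lt^j}=\tilde D_x^i\tilde D_z^{l-1}\tilde D_t^j(G)$. - $\tilde D_z u_{x^it^j}=u_{x^izt^j}$, $\tilde D_zu_{x^iz^lt^j}=u_{x^iz^{l+1}t^j}$, $\tilde D_zu_{x^iy^kt^j}=\tilde D_x^i\tilde D_y^{k-1}\tilde D_t^j(G)$. - $\tilde D_xq_\alpha^{a,b}=q_\alpha^{a+1,b}$, $\tilde D_zq_\alpha^{a,b}=q_\alpha^{a,b+1}$, $\tilde D_yq_\alpha^{a,b}=\tilde D_x^a\tilde D_z^b(u_xq_\alpha^{1,0}+q_{\alpha-1}^{1,0})$, $\tilde D_tq_\alpha^{a,b}=\tilde D_x^a\tilde D_z^b(u_zq_\alpha^{1,0}+q_{\alpha-1}^{0,1})$. - $\tilde D_xm_\alpha^{a,b}=m_\alpha^{a+1,b}$, $\tilde D_zm_\alpha^{a,b}=m_\alpha^{a,b+1}$, $\tilde D_ym_\alpha^{a,b}=\tilde D_x^a\tilde D_z^b\big(u_xm_\alpha^{1,0}-\frac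 zt m_\alpha^{1,0}-\frac1t m_{\alpha-1}^{1,0}\big)$, $\tilde D_tm_\alpha^{a,b}=\tilde D_x^a\tilde D_z^b\big(u_zm_\alpha^{1,0}-\frac zt m_\alpha^{0,1}-\frac1t m_{\alpha-1}^{0,1}\big)$. - $\tilde D_yr_\beta^{a,b}=r_\beta^{a+1,b}$, $\tilde D_tr_\beta^{a,b}=r_\beta^{a,b+1}$, and inductively on $\beta\ge1$: $\tilde D_xr_\beta^{a,b}=\tilde D_y^a\tilde D_t^b(u_x\tilde D_xr_{\beta-1}-\tilde D_yr_{\beta-1})$, $\tilde D_zr_\beta^{a,b}=\tilde D_y^a\tilde D_t^b(u_z\tilde D_xr_{\beta-1}-\tilde D_tr_{\beta-1})$. These four derivations pairwise commute. Subscripts denote total derivatives: $q_{\alpha,x}=\tilde D_xq_\alpha=q_\alpha^{1,0}$, $m_{\alpha,x}=\tilde D_xm_\alpha=m_\alpha^{1,0}$, $r_{\beta,x}=\tilde D_xr_\beta$ (so $r_{0,x}=-u_x$), etc.; $\tilde D_{yz}=\tilde D_y\tilde D_z$, etc. **$\tau^W$-symmetries.** $\mathrm{sym}_{\mathcal A}^{\tau^W}(\mathcal E)\subset\mathcal A^{\mathbb N}$ is the real vector space of all $P\in\mathcal A^{\mathbb N}$ satisfying, for all $\alpha\ge0$, $\beta\ge2$, with $p_{-1}^q=p_{-1}^m=0$: - (NS1) $\tilde D_{yz}(p_0)-\tilde D_{tx}(p_0)+u_z\tilde D_{xx}(p_0)-u_x\tilde D_{xz}(p_0)+u_{xx}\tilde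 D_z(p_0)-u_{xz}\tilde D_x(p_0)=0$; - (NS2) $\tilde D_t(p_\alpha^q)-u_z\tilde D_x(p_\alpha^q)-q_{\alpha,x}\tilde D_z(p_0)-\tilde D_z(p_{\alpha-1}^q)=0$; - (NS3) $\tilde D_y(p_\alpha^q)-u_x\tilde D_x(p_\alpha^q)-q_{\alpha,x}\tilde D_x(p_0)-\tilde D_x(p_{\alpha-1}^q)=0$; - (NS4) $\tilde D_t(p_\alpha^m)-u_z\tilde D_x(p_\alpha^m)-m_{\alpha,x}\tilde D_z(p_0)+\frac zt\tilde D_z(p_\alpha^m)+\frac1t\tilde D_z(p_{\alpha-1}^m)=0$; - (NS5) $\tilde D_y(p_\alpha^m)-u_x\tilde D_x(p_\alpha^m)-m_{\alpha,x}\tilde D_x(p_0)+\frac zt\tilde D_x(p_\alpha^m)+\frac1t\tilde D_x(p_{\alpha-1}^m)=0$; - (NS6) $\tilde D_x(p_1^r)-\tilde D_y(p_0)+2u_x\tilde D_x(p_0)=0$; - (NS7) $\tilde D_z(p_1^r)-\tilde D_t(p_0)+u_x\tilde D_z(p_0)+u_z\tilde D_x(p_0)=0$; - (NS8) $\tilde D_x(p_\beta^r)-u_x\tilde D_x(p_{\beta-1}^r)-r_{\beta-1,x}\tilde D_x(p_0)+\tilde D_y(p_{\beta-1}^r)=0$; - (NS9) $\tilde D_z(p_\beta^r)-u_z\tilde D_x(p_{\beta-1}^r)-r_{\beta-1,x}\tilde D_z(p_0)+\tilde D_t(p_{\beta-1}^r)=0$. *)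

theory Defs
  imports "HOL-Analysis.Analysis" "HOL-Library.Function_Algebras"
begin

section \<open>Coordinates and smooth functions\<close>

text \<open>
  \<open>CU i j\<close> is \<open>u_{x^i t^j}\<close>. Indices that start at 1 are shifted:
  \<open>CUY i k j\<close> is \<open>u_{x^i y^(k+1) t^j}\<close>, \<open>CUZ i l j\<close> is \<open>u_{x^i z^(l+1) t^j}\<close>, and
  \<open>CR k a b\<close> is \<open>r_(k+1)^{a,b}\<close>. The functions \<open>u_xyt\<close>, \<open>u_xzt\<close>, \<open>r_var\<close> below take
  the unshifted indices and are only meaningful when the shifted index is at least 1.
\<close>

datatype coord = CX | CY | CZ | CT
  | CU nat nat | CUY nat nat nat | CUZ nat nat nat
  | CQ nat nat nat | CM nat nat nat | CR nat nat nat

type_synonym pt = "coord \<Rightarrow> real"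

definition partial :: "coord \<Rightarrow> (pt \<Rightarrow> real) \<Rightarrow> pt \<Rightarrow> real" where
  "partial c f = (\<lambda>p. deriv (\<lambda>s. f (p(c := s))) (p c))"

definition depends_on :: "coord set \<Rightarrow> (pt \<Rightarrow> real) \<Rightarrow> bool" where
  "depends_on K f \<longleftrightarrow> (\<forall>p p'. (\<forall>c\<in>K. p c = p' c) \<longrightarrow> f p = f p')"

text \<open>
  Points carry the product topology. For a function of finitely many coordinates, continuity in
  this topology is continuity on the corresponding finite-dimensional space, so \<open>smooth\<close> says that
  the iterated partial derivatives of all orders exist and are continuous.
\<close>

definition smooth :: "(pt \<Rightarrow> real) \<Rightarrow> bool" where
  "smooth f \<longleftrightarrow> (\<exists>K. finite K \<and> depends_on K f) \<and>
     (\<forall>cs. continuous_on UNIV (foldr partial cs f) \<and>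
       (\<forall>c p. (\<lambda>s. foldr partial cs f (p(c := s))) field_differentiable at (p c)))"

inductive_set laurent :: "(pt \<Rightarrow> real) set" where
  const: "(\<lambda>_. k) \<in> laurent"
| coord: "(\<lambda>p. p c) \<in> laurent"
| inv_coord: "(\<lambda>p. inverse (p c)) \<in> laurent"
| add: "f \<in> laurent \<Longrightarrow> g \<in> laurent \<Longrightarrow> (\<lambda>p. f p + g p) \<in> laurent"
| mult: "f \<in> laurent \<Longrightarrow> g \<in> laurent \<Longrightarrow> (\<lambda>p. f p * g p) \<in> laurent"

inductive_set gen_alg :: "(pt \<Rightarrow> real) set" where
  laurent: "f \<in> laurent \<Longrightarrow> f \<in> gen_alg"
| smooth: "smooth f \<Longrightarrow> f \<in> gen_alg"
| add: "f \<in> gen_alg \<Longrightarrow> g \<in> gen_alg \<Longrightarrow> (\<lambda>p. f p + g p) \<in> gen_alg"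
| mult: "f \<in> gen_alg \<Longrightarrow> g \<in> gen_alg \<Longrightarrow> (\<lambda>p. f p * g p) \<in> gen_alg"


section \<open>The algebra\<close>

definition agree :: "(pt \<Rightarrow> real) \<Rightarrow> (pt \<Rightarrow> real) \<Rightarrow> bool" where
  "agree f g \<longleftrightarrow> (\<exists>S. finite S \<and> (\<forall>p. (\<forall>c\<in>S. p c \<noteq> 0) \<longrightarrow> f p = g p))"

text \<open>
  Elements of the algebra are represented by total functions whose values where an inverted
  coordinate vanishes are irrelevant. The set of representatives is closed under \<open>agree\<close>, so it
  does not matter which values \<open>inverse\<close> and \<open>deriv\<close> take there.
\<close>

definition in_alg :: "(pt \<Rightarrow> real) \<Rightarrow> bool" where
  "in_alg f \<longleftrightarrow> (\<exists>g\<in>gen_alg. agree f g)"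

lemma agree_refl [simp]: "agree f f"
  unfolding agree_def by blast

lemma agree_sym: "agree f g \<Longrightarrow> agree g f"
  unfolding agree_def by metis

lemma agree_lift2:
  assumes "agree f f'" "agree g g'"
    and "\<And>p. f p = f' p \<Longrightarrow> g p = g' p \<Longrightarrow> h p = h' p"
  shows "agree h h'"
proof -
  obtain S where S: "finite S" "\<And>p. \<forall>c\<in>S. p c \<noteq> 0 \<Longrightarrow> f p = f' p"
    using assms(1) unfolding agree_def by auto
  obtain T where T: "finite T" "\<And>p. \<forall>c\<in>T. p c \<noteq> 0 \<Longrightarrow> g p = g' p"
    using assms(2) unfolding agree_def by auto
  show ?thesis
    unfolding agree_def
    by (rule exI[of _ "S \<union> T"]) (use S T assms(3) in auto)
qed

lemma agree_trans: "agree f g \<Longrightarrow> agree g h \<Longrightarrow> agree f h"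
  by (rule agree_lift2[of f g g h]) auto

lemma agree_add: "agree f f' \<Longrightarrow> agree g g' \<Longrightarrow> agree (\<lambda>p. f p + g p) (\<lambda>p. f' p + g' p)"
  by (rule agree_lift2[of f f' g g']) auto

lemma agree_mult: "agree f f' \<Longrightarrow> agree g g' \<Longrightarrow> agree (\<lambda>p. f p * g p) (\<lambda>p. f' p * g' p)"
  by (rule agree_lift2[of f f' g g']) auto

lemma in_alg_gen: "f \<in> gen_alg \<Longrightarrow> in_alg f"
  unfolding in_alg_def by (metis agree_refl)

lemma in_alg_const [simp]: "in_alg (\<lambda>_. k)"
  by (intro in_alg_gen gen_alg.laurent laurent.const)

lemma in_alg_add: "in_alg f \<Longrightarrow> in_alg g \<Longrightarrow> in_alg (\<lambda>p. f p + g p)"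
  unfolding in_alg_def by (metis agree_add gen_alg.add)

lemma in_alg_mult: "in_alg f \<Longrightarrow> in_alg g \<Longrightarrow> in_alg (\<lambda>p. f p * g p)"
  unfolding in_alg_def by (metis agree_mult gen_alg.mult)

lemma in_alg_agree: "in_alg f \<Longrightarrow> agree f g \<Longrightarrow> in_alg g"
  unfolding in_alg_def by (meson agree_sym agree_trans)

quotient_type alg = "pt \<Rightarrow> real" / partial: "\<lambda>f g. in_alg f \<and> in_alg g \<and> agree f g"
proof (rule part_equivpI)
  show "\<exists>f. in_alg f \<and> in_alg f \<and> agree f f"
    by (rule exI[of _ "\<lambda>_. 0"]) simp
  show "symp (\<lambda>f g. in_alg f \<and> in_alg g \<and> agree f g)"
    by (auto intro: sympI agree_sym)
  show "transp (\<lambda>f g. in_alg f \<and> in_alg g \<and> agree f g)"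
    by (auto intro!: transpI intro: agree_trans)
qed

instantiation alg :: "{comm_ring_1, real_algebra_1}"
begin

lift_definition zero_alg :: alg is "\<lambda>_. 0" by simp
lift_definition one_alg :: alg is "\<lambda>_. 1" by simp
lift_definition plus_alg :: "alg \<Rightarrow> alg \<Rightarrow> alg" is "\<lambda>f g p. f p + g p"
  by (auto intro: in_alg_add agree_add)
lift_definition times_alg :: "alg \<Rightarrow> alg \<Rightarrow> alg" is "\<lambda>f g p. f p * g p"
  by (auto intro: in_alg_mult agree_mult)
lift_definition scaleR_alg :: "real \<Rightarrow> alg \<Rightarrow> alg" is "\<lambda>k f p. k * f p"
  by (auto intro: in_alg_mult[OF in_alg_const] agree_mult[OF agree_refl])
lift_definition uminus_alg :: "alg \<Rightarrow> alg" is "\<lambda>f p. - f p"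
proof -
  fix f g assume "in_alg f \<and> in_alg g \<and> agree f g"
  then show "in_alg (\<lambda>p. - f p) \<and> in_alg (\<lambda>p. - g p) \<and> agree (\<lambda>p. - f p) (\<lambda>p. - g p)"
    using in_alg_mult[OF in_alg_const[of "-1"], of f] in_alg_mult[OF in_alg_const[of "-1"], of g]
      agree_mult[OF agree_refl[of "\<lambda>_. -1"], of f g] by simp
qed
definition minus_alg :: "alg \<Rightarrow> alg \<Rightarrow> alg" where "minus_alg a b = a + - b"

instance
proof
  have ne: "\<not> agree (\<lambda>_. 0) (\<lambda>_. 1)"
    unfolding agree_def by (auto intro: exI[of _ "\<lambda>_. 1"])
  show "(0::alg) \<noteq> 1" by transfer (use ne in simp)
  fix a b c :: alg and k l :: real
  show "a * 1 = a" by transfer simp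
  show "a * (b + c) = a * b + a * c"
    by transfer (auto simp: algebra_simps intro!: in_alg_mult in_alg_add agree_add agree_mult)
  show "a - b = a + - b" by (rule minus_alg_def)
  show "a * b * c = a * (b * c)"
    by transfer (auto simp: ac_simps intro!: in_alg_mult agree_mult)
  show "a * b = b * a"
    by transfer (auto simp: ac_simps intro!: in_alg_mult agree_mult)
  show "1 * a = a" by transfer simp
  show "a + b + c = a + (b + c)"
    by transfer (auto simp: ac_simps intro!: in_alg_add agree_add)
  show "a + b = b + a"
    by transfer (auto simp: ac_simps intro!: in_alg_add agree_add)
  show "0 + a = a" by transfer simp
  show "- a + a = 0" by transfer simp
  show "(a + b) * c = a * c + b * c"
    by transfer (auto simp: algebra_simps intro!: in_alg_mult in_alg_add agree_add agree_mult)
  show "k *\<^sub>R (a + b) = k *\<^sub>R a + k *\<^sub>R b"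
    by transfer (auto simp: algebra_simps intro!: in_alg_mult in_alg_add agree_add agree_mult)
  show "(k + l) *\<^sub>R a = k *\<^sub>R a + l *\<^sub>R a"
    by transfer (auto simp: algebra_simps intro!: in_alg_mult in_alg_add agree_add agree_mult)
  show "k *\<^sub>R l *\<^sub>R a = (k * l) *\<^sub>R a"
    by transfer (auto simp: mult.assoc intro!: in_alg_mult agree_mult)
  show "1 *\<^sub>R a = a" by transfer simp
  show "k *\<^sub>R a * b = k *\<^sub>R (a * b)"
    by transfer (auto simp: ac_simps intro!: in_alg_mult agree_mult)
  show "a * k *\<^sub>R b = k *\<^sub>R (a * b)"
    by transfer (auto simp: ac_simps intro!: in_alg_mult agree_mult)
qed

end

lift_definition var :: "coord \<Rightarrow> alg" is "\<lambda>c p. p c"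
  by (auto intro!: in_alg_gen gen_alg.laurent laurent.coord)

lift_definition inv_var :: "coord \<Rightarrow> alg" is "\<lambda>c p. inverse (p c)"
  by (auto intro!: in_alg_gen gen_alg.laurent laurent.inv_coord)

lemma var_inv_var: "var c * inv_var c = 1"
proof (transfer, intro conjI)
  fix c :: coord
  show "in_alg (\<lambda>p. p c * inverse (p c))"
    by (intro in_alg_mult in_alg_gen gen_alg.laurent laurent.coord laurent.inv_coord)
  show "agree (\<lambda>p. p c * inverse (p c)) (\<lambda>_. 1)"
    unfolding agree_def by (rule exI[of _ "{c}"]) simp
qed simp


section \<open>Partial derivatives and vector fields\<close>

lemma depends_on_partial:
  assumes "depends_on K f" shows "depends_on K (partial c f)"
  unfolding depends_on_def
proof (intro allI impI)
  fix p p' :: pt assume eq: "\<forall>c\<in>K. p c = p' c"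
  show "partial c f p = partial c f p'"
  proof (cases "c \<in> K")
    case True
    have "(\<lambda>s. f (p(c := s))) = (\<lambda>s. f (p'(c := s)))"
      using assms eq unfolding depends_on_def by (intro ext) (simp add: fun_upd_def)
    then show ?thesis using True eq by (simp add: partial_def)
  next
    case False
    have "(\<lambda>s. f (p(c := s))) = (\<lambda>_. f p)" "(\<lambda>s. f (p'(c := s))) = (\<lambda>_. f p')"
      using assms False unfolding depends_on_def by (intro ext; metis fun_upd_other)+
    then show ?thesis by (simp add: partial_def)
  qed
qed

lemma partial_not_dep:
  assumes "depends_on K f" "c \<notin> K" shows "partial c f = (\<lambda>_. 0)"
proof
  fix p
  have "(\<lambda>s. f (p(c := s))) = (\<lambda>_. f p)"
    using assms unfolding depends_on_def by (intro ext) (metis fun_upd_other)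
  then show "partial c f p = 0" by (simp add: partial_def)
qed

lemma eventually_upd_nonzero:
  assumes "finite S" "\<forall>d\<in>S. p d \<noteq> (0::real)"
  shows "\<forall>\<^sub>F s in nhds (p c). \<forall>d\<in>S. (p(c := s)) d \<noteq> 0"
proof -
  have "\<forall>\<^sub>F s in nhds (p c). (p(c := s)) d \<noteq> 0" if "d \<in> S" for d
  proof (cases "d = c")
    case True
    then show ?thesis using assms that t1_space_nhds[of "p c" 0] by simp
  next
    case False
    then show ?thesis using assms that by simp
  qed
  then show ?thesis using assms(1) by (simp add: eventually_ball_finite)
qed

lemma agree_partial:
  assumes "agree f g" shows "agree (partial c f) (partial c g)"
proof -
  obtain S where S: "finite S" "\<And>p. \<forall>d\<in>S. p d \<noteq> 0 \<Longrightarrow> f p = g p"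
    using assms unfolding agree_def by auto
  have "partial c f p = partial c g p" if "\<forall>d\<in>S. p d \<noteq> 0" for p
  proof -
    have "\<forall>\<^sub>F s in nhds (p c). f (p(c := s)) = g (p(c := s))"
      by (rule eventually_mono[OF eventually_upd_nonzero[OF S(1) that]]) (rule S(2))
    then show ?thesis unfolding partial_def by (rule deriv_cong_ev) simp
  qed
  then show ?thesis unfolding agree_def using S(1) by blast
qed

definition nice :: "(pt \<Rightarrow> real) \<Rightarrow> bool" where
  "nice f \<longleftrightarrow> (\<exists>K. finite K \<and> depends_on K f) \<and>
     (\<exists>S. finite S \<and> (\<forall>p c. (\<forall>d\<in>S. p d \<noteq> 0) \<longrightarrow>
        (\<lambda>s. f (p(c := s))) field_differentiable at (p c))) \<and>
     (\<forall>c. in_alg (partial c f))"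

lemma nice_add_mult:
  assumes "nice f" "nice g" "in_alg f" "in_alg g"
  shows "nice (\<lambda>p. f p + g p)" "nice (\<lambda>p. f p * g p)"
proof -
  obtain K L where KL: "finite K" "depends_on K f" "finite L" "depends_on L g"
    using assms unfolding nice_def by auto
  have dep: "depends_on (K \<union> L) (\<lambda>p. f p + g p)" "depends_on (K \<union> L) (\<lambda>p. f p * g p)"
    using KL unfolding depends_on_def by (metis UnCI)+
  obtain S where S: "finite S" "\<And>p c. \<forall>d\<in>S. p d \<noteq> 0 \<Longrightarrow>
      (\<lambda>s. f (p(c := s))) field_differentiable at (p c)"
    using assms unfolding nice_def by metis
  obtain T where T: "finite T" "\<And>p c. \<forall>d\<in>T. p d \<noteq> 0 \<Longrightarrow>
      (\<lambda>s. g (p(c := s))) field_differentiable at (p c)"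
    using assms unfolding nice_def by metis
  have diff: "(\<lambda>s. f (p(c := s)) + g (p(c := s))) field_differentiable at (p c)"
      "(\<lambda>s. f (p(c := s)) * g (p(c := s))) field_differentiable at (p c)"
      "partial c (\<lambda>p. f p + g p) p = partial c f p + partial c g p"
      "partial c (\<lambda>p. f p * g p) p = f p * partial c g p + partial c f p * g p"
    if "\<forall>d\<in>S \<union> T. p d \<noteq> 0" for p c
    using S(2)[of p c] T(2)[of p c] that
    by (auto simp: partial_def field_differentiable_add field_differentiable_mult)
  have ag: "agree (\<lambda>p. partial c f p + partial c g p) (partial c (\<lambda>p. f p + g p))"
      "agree (\<lambda>p. f p * partial c g p + partial c f p * g p) (partial c (\<lambda>p. f p * g p))" for c
    unfolding agree_def using diff(3,4) S(1) T(1)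
    by (metis finite_UnI)+
  have pf: "in_alg (partial c f)" "in_alg (partial c g)" for c
    using assms unfolding nice_def by auto
  have ia: "in_alg (partial c (\<lambda>p. f p + g p))" "in_alg (partial c (\<lambda>p. f p * g p))" for c
    by (rule in_alg_agree[OF _ ag(1)] in_alg_agree[OF _ ag(2)], intro in_alg_add in_alg_mult pf assms)+
  have fin: "finite (K \<union> L)" "finite (S \<union> T)" using KL S T by auto
  show "nice (\<lambda>p. f p + g p)" unfolding nice_def using fin dep(1) diff(1) ia(1) by blast
  show "nice (\<lambda>p. f p * g p)" unfolding nice_def using fin dep(2) diff(2) ia(2) by blast
qed

lemma smooth_partial:
  assumes "smooth f" shows "smooth (partial c f)"
  unfolding smooth_def
proof (intro conjI allI)
  show "\<exists>K. finite K \<and> depends_on K (partial c f)"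
    using assms depends_on_partial unfolding smooth_def by blast
  fix cs
  have "foldr partial cs (partial c f) = foldr partial (cs @ [c]) f" by simp
  then show "continuous_on UNIV (foldr partial cs (partial c f))"
    "\<And>d p. (\<lambda>s. foldr partial cs (partial c f) (p(d := s))) field_differentiable at (p d)"
    using assms unfolding smooth_def by metis+
qed

lemma nice_laurent: "f \<in> laurent \<Longrightarrow> nice f"
proof (induction rule: laurent.induct)
  case (const k)
  have "partial c (\<lambda>_. k) = (\<lambda>_. 0)" for c by (simp add: partial_def)
  then show ?case unfolding nice_def
    by (auto simp: depends_on_def intro: exI[of _ "{}"])
next
  case (coord c)
  have "partial d (\<lambda>p. p c) = (\<lambda>_. if d = c then 1 else 0)" for d
    by (auto simp: partial_def)
  moreover have "(\<lambda>s. (p(d := s)) c) field_differentiable at (p d)" for p :: pt and d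
    by (cases "d = c") auto
  moreover have "depends_on {c} (\<lambda>p. p c)" by (simp add: depends_on_def)
  ultimately show ?case unfolding nice_def by (metis finite.simps in_alg_const)
next
  case (inv_coord c)
  have dep: "depends_on {c} (\<lambda>p. inverse (p c))" by (simp add: depends_on_def)
  have D: "((\<lambda>s. inverse ((p(c := s)) c)) has_field_derivative - (inverse (p c) * inverse (p c)))
      (at (p c))" if "p c \<noteq> 0" for p :: pt
    using DERIV_inverse'[OF DERIV_ident that] by (simp add: mult.assoc)
  have diff: "(\<lambda>s. inverse ((p(d := s)) c)) field_differentiable at (p d)"
    if "p c \<noteq> 0" for p :: pt and d
    using D[of p] that by (cases "d = c") (auto simp: field_differentiable_def)
  have "in_alg (partial d (\<lambda>p. inverse (p c)))" for d
  proof (cases "d = c")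
    case True
    have "agree (\<lambda>p. (-1) * (inverse (p c) * inverse (p c))) (partial c (\<lambda>p. inverse (p c)))"
      unfolding agree_def partial_def
      by (rule exI[of _ "{c}"]) (use DERIV_imp_deriv[OF D] in simp)
    moreover have "in_alg (\<lambda>p. (-1) * (inverse (p c) * inverse (p c)))"
      by (intro in_alg_mult in_alg_const in_alg_gen gen_alg.laurent laurent.inv_coord)
    ultimately show ?thesis using in_alg_agree True by blast
  next
    case False
    then show ?thesis using partial_not_dep[OF dep, of d] by simp
  qed
  then show ?case unfolding nice_def using dep diff
    by (metis finite.emptyI finite_insert insertI1)
next
  case (add f g)
  then show ?case by (intro nice_add_mult in_alg_gen gen_alg.laurent)
next
  case (mult f g)
  then show ?case by (intro nice_add_mult in_alg_gen gen_alg.laurent)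
qed

lemma nice_gen: "f \<in> gen_alg \<Longrightarrow> nice f"
proof (induction rule: gen_alg.induct)
  case (laurent f)
  then show ?case by (rule nice_laurent)
next
  case (smooth f)
  have "(\<lambda>s. f (p(c := s))) field_differentiable at (p c)" for p c
    using smooth unfolding smooth_def by (metis foldr_Nil id_apply)
  moreover have "in_alg (partial c f)" for c
    using smooth_partial[OF smooth] by (intro in_alg_gen gen_alg.smooth)
  ultimately show ?case using smooth unfolding nice_def smooth_def by blast
next
  case (add f g)
  then show ?case by (intro nice_add_mult in_alg_gen)
next
  case (mult f g)
  then show ?case by (intro nice_add_mult in_alg_gen)
qed

lemma in_alg_partial:
  assumes "in_alg f" shows "in_alg (partial c f)"
proof -
  obtain g where g: "g \<in> gen_alg" "agree f g" using assms unfolding in_alg_def by blast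
  have "in_alg (partial c g)" using nice_gen[OF g(1)] unfolding nice_def by blast
  then show ?thesis by (rule in_alg_agree[OF _ agree_partial[OF agree_sym[OF g(2)]]])
qed

lift_definition pd :: "coord \<Rightarrow> alg \<Rightarrow> alg" is partial
  by (auto intro: in_alg_partial agree_partial)

text \<open>The sum below is finite for every \<open>f\<close>; see \<open>finite_pd_nonzero\<close>.\<close>

definition vfield :: "(coord \<Rightarrow> alg) \<Rightarrow> alg \<Rightarrow> alg" where
  "vfield a f = (\<Sum>c | pd c f \<noteq> 0. a c * pd c f)"

lemma finite_pd_nonzero: "finite {c. pd c f \<noteq> 0}"
proof -
  have "\<exists>K. finite K \<and> (\<forall>c. c \<notin> K \<longrightarrow> pd c f = 0)"
  proof (transfer)
    fix f assume "in_alg f \<and> in_alg f \<and> agree f f"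
    then obtain g where g: "g \<in> gen_alg" "agree f g" unfolding in_alg_def by blast
    obtain K where K: "finite K" "depends_on K g"
      using nice_gen[OF g(1)] unfolding nice_def by blast
    have "in_alg (partial c f) \<and> in_alg (\<lambda>_. 0) \<and> agree (partial c f) (\<lambda>_. 0)" if "c \<notin> K" for c
      using agree_partial[OF g(2), of c] partial_not_dep[OF K(2) that]
        in_alg_partial[OF in_alg_agree[OF in_alg_gen[OF g(1)] agree_sym[OF g(2)]], of c] by simp
    then show "\<exists>K. finite K \<and> (\<forall>c. c \<notin> K \<longrightarrow>
        in_alg (partial c f) \<and> in_alg (\<lambda>_. 0) \<and> agree (partial c f) (\<lambda>_. 0))"
      using K(1) by blast
  qed
  then obtain K where "finite K" "{c. pd c f \<noteq> 0} \<subseteq> K" by blast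
  then show ?thesis by (rule finite_subset[rotated])
qed

lemma partial_add_mult:
  assumes "in_alg f" "in_alg g"
  shows "agree (partial c (\<lambda>p. f p + g p)) (\<lambda>p. partial c f p + partial c g p)"
    and "agree (partial c (\<lambda>p. f p * g p)) (\<lambda>p. f p * partial c g p + partial c f p * g p)"
proof -
  obtain f' g' where f': "f' \<in> gen_alg" "agree f f'" and g': "g' \<in> gen_alg" "agree g g'"
    using assms unfolding in_alg_def by blast
  obtain S where S: "finite S" "\<And>p c. \<forall>d\<in>S. p d \<noteq> 0 \<Longrightarrow>
      (\<lambda>s. f' (p(c := s))) field_differentiable at (p c)"
    using nice_gen[OF f'(1)] unfolding nice_def by metis
  obtain T where T: "finite T" "\<And>p c. \<forall>d\<in>T. p d \<noteq> 0 \<Longrightarrow>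
      (\<lambda>s. g' (p(c := s))) field_differentiable at (p c)"
    using nice_gen[OF g'(1)] unfolding nice_def by metis
  have "partial c (\<lambda>p. f' p + g' p) p = partial c f' p + partial c g' p"
      "partial c (\<lambda>p. f' p * g' p) p = f' p * partial c g' p + partial c f' p * g' p"
    if "\<forall>d\<in>S \<union> T. p d \<noteq> 0" for p
    using S(2)[of p c] T(2)[of p c] that by (auto simp: partial_def)
  then have "agree (partial c (\<lambda>p. f' p + g' p)) (\<lambda>p. partial c f' p + partial c g' p)"
      "agree (partial c (\<lambda>p. f' p * g' p)) (\<lambda>p. f' p * partial c g' p + partial c f' p * g' p)"
    unfolding agree_def using S(1) T(1) by (metis finite_UnI)+
  moreover have "agree (partial c (\<lambda>p. f p + g p)) (partial c (\<lambda>p. f' p + g' p))"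
      "agree (partial c (\<lambda>p. f p * g p)) (partial c (\<lambda>p. f' p * g' p))"
    by (intro agree_partial agree_add agree_mult f'(2) g'(2))+
  moreover have "agree (\<lambda>p. partial c f' p + partial c g' p) (\<lambda>p. partial c f p + partial c g p)"
      "agree (\<lambda>p. f' p * partial c g' p + partial c f' p * g' p)
         (\<lambda>p. f p * partial c g p + partial c f p * g p)"
    by (intro agree_partial agree_add agree_mult agree_sym[OF f'(2)] agree_sym[OF g'(2)])+
  ultimately show "agree (partial c (\<lambda>p. f p + g p)) (\<lambda>p. partial c f p + partial c g p)"
    "agree (partial c (\<lambda>p. f p * g p)) (\<lambda>p. f p * partial c g p + partial c f p * g p)"
    by (meson agree_trans)+
qed

lemma pd_add: "pd c (f + g) = pd c f + pd c g"
  by transfer (simp add: in_alg_partial in_alg_add partial_add_mult)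

lemma pd_mult: "pd c (f * g) = f * pd c g + pd c f * g"
  by transfer (simp add: in_alg_partial in_alg_add in_alg_mult partial_add_mult)

lemma vfield_eq:
  assumes "finite K" "{c. pd c f \<noteq> 0} \<subseteq> K" shows "vfield a f = (\<Sum>c\<in>K. a c * pd c f)"
  unfolding vfield_def by (rule sum.mono_neutral_left) (use assms in auto)

lemma vfield_add: "vfield a (f + g) = vfield a f + vfield a g"
  and vfield_mult: "vfield a (f * g) = f * vfield a g + vfield a f * g"
proof -
  define K where "K = {c. pd c f \<noteq> 0} \<union> {c. pd c g \<noteq> 0}"
  have K: "finite K" "{c. pd c f \<noteq> 0} \<subseteq> K" "{c. pd c g \<noteq> 0} \<subseteq> K"
    "{c. pd c (f + g) \<noteq> 0} \<subseteq> K" "{c. pd c (f * g) \<noteq> 0} \<subseteq> K"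
    by (auto simp: K_def finite_pd_nonzero pd_add pd_mult)
  show "vfield a (f + g) = vfield a f + vfield a g"
    by (simp add: vfield_eq[OF K(1) K(2)] vfield_eq[OF K(1) K(3)] vfield_eq[OF K(1) K(4)]
        pd_add algebra_simps sum.distrib)
  show "vfield a (f * g) = f * vfield a g + vfield a f * g"
    by (simp add: vfield_eq[OF K(1) K(2)] vfield_eq[OF K(1) K(3)] vfield_eq[OF K(1) K(5)]
        pd_mult algebra_simps sum.distrib sum_distrib_left)
qed

lemma vfield_minus: "vfield a (- f) = - vfield a f"
proof -
  have "vfield a 0 + vfield a 0 = vfield a 0" using vfield_add[of a 0 0] by simp
  moreover have "vfield a (- f) + vfield a f = vfield a 0" using vfield_add[of a "- f" f] by simp
  ultimately show ?thesis by (simp add: eq_neg_iff_add_eq_0)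
qed

lemma pd_var: "pd d (var c) = (if d = c then 1 else 0)"
proof -
  have "partial d (\<lambda>p. p c) = (\<lambda>_. if d = c then 1 else 0)"
    by (auto simp: partial_def)
  then show ?thesis by (cases "d = c"; simp; transfer) (simp_all)
qed

lemma vfield_var [simp]: "vfield a (var c) = a c"
proof -
  have "{d. pd d (var c) \<noteq> 0} = {c}" by (auto simp: pd_var)
  then show ?thesis by (simp add: vfield_def pd_var)
qed


section \<open>Total derivatives\<close>

definition u_xt :: "nat \<Rightarrow> nat \<Rightarrow> alg" where "u_xt i j = var (CU i j)"
definition u_xyt :: "nat \<Rightarrow> nat \<Rightarrow> nat \<Rightarrow> alg" where "u_xyt i k j = var (CUY i (k - 1) j)"
definition u_xzt :: "nat \<Rightarrow> nat \<Rightarrow> nat \<Rightarrow> alg" where "u_xzt i l j = var (CUZ i (l - 1) j)"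
definition q_var :: "nat \<Rightarrow> nat \<Rightarrow> nat \<Rightarrow> alg" where "q_var \<alpha> a b = var (CQ \<alpha> a b)"
definition m_var :: "nat \<Rightarrow> nat \<Rightarrow> nat \<Rightarrow> alg" where "m_var \<alpha> a b = var (CM \<alpha> a b)"
definition r_var :: "nat \<Rightarrow> nat \<Rightarrow> nat \<Rightarrow> alg" where "r_var \<beta> a b = var (CR (\<beta> - 1) a b)"

definition r_fun :: "nat \<Rightarrow> alg" where
  "r_fun \<beta> = (if \<beta> = 0 then - u_xt 0 0 else r_var \<beta> 0 0)"

definition prev :: "(nat \<Rightarrow> 'a::zero) \<Rightarrow> nat \<Rightarrow> 'a" where
  "prev s \<alpha> = (if \<alpha> = 0 then 0 else s (\<alpha> - 1))"

abbreviation u_x :: alg where "u_x \<equiv> u_xt 1 0"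
abbreviation u_z :: alg where "u_z \<equiv> u_xzt 0 1 0"
abbreviation z_var :: alg where "z_var \<equiv> var CZ"
abbreviation t_var :: alg where "t_var \<equiv> var CT"
abbreviation inv_t :: alg where "inv_t \<equiv> inv_var CT"

definition G :: alg where
  "G = u_xt 1 1 - u_z * u_xt 2 0 + u_x * u_xzt 1 1 0"

text \<open>
  The components of the four fields refer to iterates of the fields themselves. To resolve this,
  \<open>Dx0\<close> and \<open>Dz0\<close> are \<open>Dx\<close> and \<open>Dz\<close> with the components along \<open>CUY\<close> and \<open>CR\<close> replaced by 0,
  which makes no difference for functions not involving these coordinates. The lemmas at the end of
  this section state the intended rules, in terms of the full fields.
\<close>

fun Dx0_comp :: "coord \<Rightarrow> alg" where
  "Dx0_comp CX = 1"
| "Dx0_comp (CU i j) = u_xt (i + 1) j"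
| "Dx0_comp (CUZ i l j) = u_xzt (i + 1) (l + 1) j"
| "Dx0_comp (CQ \<alpha> a b) = q_var \<alpha> (a + 1) b"
| "Dx0_comp (CM \<alpha> a b) = m_var \<alpha> (a + 1) b"
| "Dx0_comp _ = 0"

definition Dx0 :: "alg \<Rightarrow> alg" where "Dx0 = vfield Dx0_comp"

fun Dz0_comp :: "coord \<Rightarrow> alg" where
  "Dz0_comp CZ = 1"
| "Dz0_comp (CU i j) = u_xzt i 1 j"
| "Dz0_comp (CUZ i l j) = u_xzt i (l + 2) j"
| "Dz0_comp (CQ \<alpha> a b) = q_var \<alpha> a (b + 1)"
| "Dz0_comp (CM \<alpha> a b) = m_var \<alpha> a (b + 1)"
| "Dz0_comp _ = 0"

definition Dz0 :: "alg \<Rightarrow> alg" where "Dz0 = vfield Dz0_comp"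

fun Dt_comp :: "coord \<Rightarrow> alg" where
  "Dt_comp CX = 0"
| "Dt_comp CY = 0"
| "Dt_comp CZ = 0"
| "Dt_comp CT = 1"
| "Dt_comp (CU i j) = u_xt i (j + 1)"
| "Dt_comp (CUY i k j) = u_xyt i (k + 1) (j + 1)"
| "Dt_comp (CUZ i l j) = u_xzt i (l + 1) (j + 1)"
| "Dt_comp (CQ \<alpha> a b) =
     (Dx0 ^^ a) ((Dz0 ^^ b) (u_z * q_var \<alpha> 1 0 + prev (\<lambda>\<alpha>. q_var \<alpha> 0 1) \<alpha>))"
| "Dt_comp (CM \<alpha> a b) =
     (Dx0 ^^ a) ((Dz0 ^^ b) (u_z * m_var \<alpha> 1 0 - z_var * inv_t * m_var \<alpha> 0 1
        - inv_t * prev (\<lambda>\<alpha>. m_var \<alpha> 0 1) \<alpha>))"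
| "Dt_comp (CR \<beta> a b) = r_var (\<beta> + 1) a (b + 1)"

definition Dt :: "alg \<Rightarrow> alg" where "Dt = vfield Dt_comp"

fun Dy_comp :: "coord \<Rightarrow> alg" where
  "Dy_comp CX = 0"
| "Dy_comp CY = 1"
| "Dy_comp CZ = 0"
| "Dy_comp CT = 0"
| "Dy_comp (CU i j) = u_xyt i 1 j"
| "Dy_comp (CUY i k j) = u_xyt i (k + 2) j"
| "Dy_comp (CUZ i l j) = (Dx0 ^^ i) ((Dz0 ^^ l) ((Dt ^^ j) G))"
| "Dy_comp (CQ \<alpha> a b) =
     (Dx0 ^^ a) ((Dz0 ^^ b) (u_x * q_var \<alpha> 1 0 + prev (\<lambda>\<alpha>. q_var \<alpha> 1 0) \<alpha>))"
| "Dy_comp (CM \<alpha> a b) =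
     (Dx0 ^^ a) ((Dz0 ^^ b) (u_x * m_var \<alpha> 1 0 - z_var * inv_t * m_var \<alpha> 1 0
        - inv_t * prev (\<lambda>\<alpha>. m_var \<alpha> 1 0) \<alpha>))"
| "Dy_comp (CR \<beta> a b) = r_var (\<beta> + 1) (a + 1) b"

definition Dy :: "alg \<Rightarrow> alg" where "Dy = vfield Dy_comp"

text \<open>\<open>r_x \<beta>\<close> is the derivative of \<open>r_fun \<beta>\<close> along \<open>Dx\<close>; see \<open>Dx_r_fun\<close> below.\<close>

fun r_x :: "nat \<Rightarrow> alg" where
  "r_x 0 = - u_x"
| "r_x (Suc \<beta>) = u_x * r_x \<beta> - Dy (r_fun \<beta>)"

fun Dx_comp :: "coord \<Rightarrow> alg" where
  "Dx_comp (CUY i k j) = u_xyt (i + 1) (k + 1) j"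
| "Dx_comp (CR \<beta> a b) = (Dy ^^ a) ((Dt ^^ b) (r_x (\<beta> + 1)))"
| "Dx_comp c = Dx0_comp c"

definition Dx :: "alg \<Rightarrow> alg" where "Dx = vfield Dx_comp"

fun Dz_comp :: "coord \<Rightarrow> alg" where
  "Dz_comp (CUY i k j) = (Dx ^^ i) ((Dy ^^ k) ((Dt ^^ j) G))"
| "Dz_comp (CR \<beta> a b) = (Dy ^^ a) ((Dt ^^ b) (u_z * Dx (r_fun \<beta>) - Dt (r_fun \<beta>)))"
| "Dz_comp c = Dz0_comp c"

definition Dz :: "alg \<Rightarrow> alg" where "Dz = vfield Dz_comp"

lift_definition only_on :: "coord set \<Rightarrow> alg \<Rightarrow> bool" is
  "\<lambda>J f. \<exists>g. in_alg g \<and> agree f g \<and> depends_on J g"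
  by (meson agree_sym agree_trans)

lemma only_on_const: "only_on J 0" "only_on J 1"
proof -
  have "\<exists>g. in_alg g \<and> agree (\<lambda>_. k) g \<and> depends_on J g" for k J
    by (rule exI[of _ "\<lambda>_. k"]) (simp add: depends_on_def)
  note * = this
  show "only_on J 0" "only_on J 1" by (transfer, rule *)+
qed

lemma only_on_var: "c \<in> J \<Longrightarrow> only_on J (var c)"
proof (transfer)
  fix c :: coord and J assume "c \<in> J"
  then show "\<exists>g. in_alg g \<and> agree (\<lambda>p. p c) g \<and> depends_on J g"
    by (intro exI[of _ "\<lambda>p. p c"])
      (auto simp: depends_on_def intro!: in_alg_gen gen_alg.laurent laurent.coord)
qed

lemma only_on_inv_var: "c \<in> J \<Longrightarrow> only_on J (inv_var c)"
proof (transfer)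
  fix c :: coord and J assume "c \<in> J"
  then show "\<exists>g. in_alg g \<and> agree (\<lambda>p. inverse (p c)) g \<and> depends_on J g"
    by (intro exI[of _ "\<lambda>p. inverse (p c)"])
      (auto simp: depends_on_def intro!: in_alg_gen gen_alg.laurent laurent.inv_coord)
qed

lemma only_on_add: "only_on J f \<Longrightarrow> only_on J g \<Longrightarrow> only_on J (f + g)"
proof (transfer, elim exE conjE)
  fix J f g f' g'
  assume "in_alg f'" "in_alg g'" "agree f f'" "agree g g'" "depends_on J f'" "depends_on J g'"
  then show "\<exists>h. in_alg h \<and> agree (\<lambda>p. f p + g p) h \<and> depends_on J h"
    by (intro exI[of _ "\<lambda>p. f' p + g' p"] conjI in_alg_add agree_add)
      (unfold depends_on_def, metis+)
qed

lemma only_on_mult: "only_on J f \<Longrightarrow> only_on J g \<Longrightarrow> only_on J (f * g)"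
proof (transfer, elim exE conjE)
  fix J f g f' g'
  assume "in_alg f'" "in_alg g'" "agree f f'" "agree g g'" "depends_on J f'" "depends_on J g'"
  then show "\<exists>h. in_alg h \<and> agree (\<lambda>p. f p * g p) h \<and> depends_on J h"
    by (intro exI[of _ "\<lambda>p. f' p * g' p"] conjI in_alg_mult agree_mult)
      (unfold depends_on_def, metis+)
qed

lemma only_on_minus: "only_on J f \<Longrightarrow> only_on J (- f)"
proof (transfer, elim exE conjE)
  fix J f f'
  assume "in_alg f'" "agree f f'" "depends_on J f'"
  then show "\<exists>h. in_alg h \<and> agree (\<lambda>p. - f p) h \<and> depends_on J h"
    using in_alg_mult[OF in_alg_const[of "-1"], of f'] agree_mult[OF agree_refl[of "\<lambda>_. -1"], of f f']
    by (intro exI[of _ "\<lambda>p. - f' p"]) (auto simp: depends_on_def)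
qed

lemma only_on_diff: "only_on J f \<Longrightarrow> only_on J g \<Longrightarrow> only_on J (f - g)"
  unfolding minus_alg_def by (intro only_on_add only_on_minus)

lemma only_on_pd: "only_on J f \<Longrightarrow> only_on J (pd c f)"
proof (transfer, elim exE conjE)
  fix J f c g
  assume "in_alg g" "agree f g" "depends_on J g"
  then show "\<exists>h. in_alg h \<and> agree (partial c f) h \<and> depends_on J h"
    by (intro exI[of _ "partial c g"] conjI in_alg_partial agree_partial depends_on_partial)
qed

lemma pd_only_on: "only_on J f \<Longrightarrow> c \<notin> J \<Longrightarrow> pd c f = 0"
proof (transfer, elim exE conjE)
  fix J f c g
  assume "in_alg f" "c \<notin> J" "in_alg g" "agree f g" "depends_on J g"
  then show "in_alg (partial c f) \<and> in_alg (\<lambda>_. 0) \<and> agree (partial c f) (\<lambda>_. 0)"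
    using agree_partial[of f g c] partial_not_dep[of J g c] in_alg_partial[of f c] by simp
qed

lemma only_on_sum: "(\<And>c. c \<in> K \<Longrightarrow> only_on J (h c)) \<Longrightarrow> only_on J (sum h K)"
  by (induction K rule: infinite_finite_induct) (auto intro: only_on_const only_on_add)

lemma only_on_vfield:
  assumes "only_on J f" "\<And>c. c \<in> J \<Longrightarrow> only_on J (a c)" shows "only_on J (vfield a f)"
proof -
  have "only_on J (a c * pd c f)" if "pd c f \<noteq> 0" for c
    using assms pd_only_on only_on_pd only_on_mult that by blast
  then show ?thesis unfolding vfield_def by (auto intro: only_on_sum)
qed

lemma vfield_cong:
  assumes "only_on J f" "\<And>c. c \<in> J \<Longrightarrow> a c = b c" shows "vfield a f = vfield b f"
proof -
  have "a c = b c" if "pd c f \<noteq> 0" for c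
    using assms pd_only_on that by blast
  then show ?thesis unfolding vfield_def by (auto intro: sum.cong)
qed

lemma funpow_cong_on:
  assumes "\<And>f. P f \<Longrightarrow> D f = D' f" "\<And>f. P f \<Longrightarrow> P (D f)" "P f"
  shows "(D ^^ n) f = (D' ^^ n) f \<and> P ((D ^^ n) f)"
  using assms by (induction n) auto

definition base_coords :: "coord set" where
  "base_coords = {c. case c of CUY _ _ _ \<Rightarrow> False | CR _ _ _ \<Rightarrow> False | _ \<Rightarrow> True}"

abbreviation based :: "alg \<Rightarrow> bool" where "based \<equiv> only_on base_coords"

lemma base_coords_cases:
  assumes "c \<in> base_coords"
  obtains "c \<in> {CX, CY, CZ, CT}" | i j where "c = CU i j" | i l j where "c = CUZ i l j"
    | \<alpha> a b where "c = CQ \<alpha> a b" | \<alpha> a b where "c = CM \<alpha> a b"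
  using assms by (cases c) (auto simp: base_coords_def)

lemma base_coords_simps [simp]:
  "CZ \<in> base_coords" "CT \<in> base_coords" "CU i j \<in> base_coords" "CUZ i l j \<in> base_coords"
  "CQ \<alpha> a b \<in> base_coords" "CM \<alpha> a b \<in> base_coords"
  by (auto simp: base_coords_def)

lemma based_vars:
  "based (u_xt i j)" "based (u_xzt i l j)" "based (q_var \<alpha> a b)" "based (m_var \<alpha> a b)"
  "based z_var" "based inv_t"
  by (auto simp: u_xt_def u_xzt_def q_var_def m_var_def intro!: only_on_var only_on_inv_var)

lemma based_prev: "(\<And>\<alpha>. based (s \<alpha>)) \<Longrightarrow> based (prev s \<alpha>)"
  by (simp add: prev_def only_on_const)

lemmas based_intros = only_on_const only_on_add only_on_diff only_on_mult based_vars based_prev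

lemma based_G: "based G"
  unfolding G_def by (intro based_intros)

lemma based_Dx0: "based f \<Longrightarrow> based (Dx0 f)"
  unfolding Dx0_def by (rule only_on_vfield) (auto elim!: base_coords_cases intro!: based_intros)

lemma based_Dz0: "based f \<Longrightarrow> based (Dz0 f)"
  unfolding Dz0_def by (rule only_on_vfield) (auto elim!: base_coords_cases intro!: based_intros)

lemma Dx0_eq: "based f \<Longrightarrow> Dx0 f = Dx f"
  unfolding Dx0_def Dx_def by (rule vfield_cong) (auto elim!: base_coords_cases)

lemma Dz0_eq: "based f \<Longrightarrow> Dz0 f = Dz f"
  unfolding Dz0_def Dz_def by (rule vfield_cong) (auto elim!: base_coords_cases)

lemma Dx0_pow: "based f \<Longrightarrow> (Dx0 ^^ n) f = (Dx ^^ n) f \<and> based ((Dx0 ^^ n) f)"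
  by (rule funpow_cong_on[of based, OF Dx0_eq based_Dx0])

lemma Dz0_pow: "based f \<Longrightarrow> (Dz0 ^^ n) f = (Dz ^^ n) f \<and> based ((Dz0 ^^ n) f)"
  by (rule funpow_cong_on[of based, OF Dz0_eq based_Dz0])

lemma Dxz0_pow: "based f \<Longrightarrow> (Dx0 ^^ a) ((Dz0 ^^ b) f) = (Dx ^^ a) ((Dz ^^ b) f)"
  using Dx0_pow Dz0_pow by metis

lemma based_Dt: "based f \<Longrightarrow> based (Dt f)"
  unfolding Dt_def
  by (rule only_on_vfield)
    (auto elim!: base_coords_cases
      intro!: based_intros Dx0_pow[THEN conjunct2] Dz0_pow[THEN conjunct2])

lemma based_Dt_pow: "based f \<Longrightarrow> based ((Dt ^^ n) f)"
  by (induction n) (auto intro: based_Dt)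

lemma D_base:
  "Dx (var CX) = 1" "Dx (var CY) = 0" "Dx (var CZ) = 0" "Dx (var CT) = 0"
  "Dy (var CX) = 0" "Dy (var CY) = 1" "Dy (var CZ) = 0" "Dy (var CT) = 0"
  "Dz (var CX) = 0" "Dz (var CY) = 0" "Dz (var CZ) = 1" "Dz (var CT) = 0"
  "Dt (var CX) = 0" "Dt (var CY) = 0" "Dt (var CZ) = 0" "Dt (var CT) = 1"
  by (simp_all add: Dx_def Dy_def Dz_def Dt_def)

lemma D_u_xt:
  "Dx (u_xt i j) = u_xt (i + 1) j" "Dt (u_xt i j) = u_xt i (j + 1)"
  "Dy (u_xt i j) = u_xyt i 1 j" "Dz (u_xt i j) = u_xzt i 1 j"
  by (simp_all add: Dx_def Dy_def Dz_def Dt_def u_xt_def u_xyt_def u_xzt_def)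

lemma D_u_xyt:
  assumes "k \<ge> 1"
  shows "Dx (u_xyt i k j) = u_xyt (i + 1) k j" "Dt (u_xyt i k j) = u_xyt i k (j + 1)"
    "Dy (u_xyt i k j) = u_xyt i (k + 1) j"
    "Dz (u_xyt i k j) = (Dx ^^ i) ((Dy ^^ (k - 1)) ((Dt ^^ j) G))"
  using assms by (simp_all add: Dx_def Dy_def Dz_def Dt_def u_xyt_def)

lemma D_u_xzt:
  assumes "l \<ge> 1"
  shows "Dx (u_xzt i l j) = u_xzt (i + 1) l j" "Dt (u_xzt i l j) = u_xzt i l (j + 1)"
    "Dy (u_xzt i l j) = (Dx ^^ i) ((Dz ^^ (l - 1)) ((Dt ^^ j) G))"
    "Dz (u_xzt i l j) = u_xzt i (l + 1) j"
proof -
  show "Dy (u_xzt i l j) = (Dx ^^ i) ((Dz ^^ (l - 1)) ((Dt ^^ j) G))"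
    using Dxz0_pow[OF based_Dt_pow[OF based_G]] by (simp add: Dy_def u_xzt_def)
qed (use assms in \<open>simp_all add: Dx_def Dz_def Dt_def u_xzt_def\<close>)

lemma D_q_var:
  "Dx (q_var \<alpha> a b) = q_var \<alpha> (a + 1) b" "Dz (q_var \<alpha> a b) = q_var \<alpha> a (b + 1)"
  "Dy (q_var \<alpha> a b) =
     (Dx ^^ a) ((Dz ^^ b) (u_x * q_var \<alpha> 1 0 + prev (\<lambda>\<alpha>. q_var \<alpha> 1 0) \<alpha>))"
  "Dt (q_var \<alpha> a b) =
     (Dx ^^ a) ((Dz ^^ b) (u_z * q_var \<alpha> 1 0 + prev (\<lambda>\<alpha>. q_var \<alpha> 0 1) \<alpha>))"
  by (simp_all add: Dx_def Dz_def Dy_def Dt_def q_var_def[of _ a b]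
      Dxz0_pow[unfolded Dx_def Dz_def] based_intros del: One_nat_def)

lemma D_m_var:
  "Dx (m_var \<alpha> a b) = m_var \<alpha> (a + 1) b" "Dz (m_var \<alpha> a b) = m_var \<alpha> a (b + 1)"
  "Dy (m_var \<alpha> a b) =
     (Dx ^^ a) ((Dz ^^ b) (u_x * m_var \<alpha> 1 0 - z_var * inv_t * m_var \<alpha> 1 0
        - inv_t * prev (\<lambda>\<alpha>. m_var \<alpha> 1 0) \<alpha>))"
  "Dt (m_var \<alpha> a b) =
     (Dx ^^ a) ((Dz ^^ b) (u_z * m_var \<alpha> 1 0 - z_var * inv_t * m_var \<alpha> 0 1
        - inv_t * prev (\<lambda>\<alpha>. m_var \<alpha> 0 1) \<alpha>))"
  by (simp_all add: Dx_def Dz_def Dy_def Dt_def m_var_def[of _ a b]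
      Dxz0_pow[unfolded Dx_def Dz_def] based_intros del: One_nat_def)

lemma Dx_r_fun: "Dx (r_fun \<beta>) = r_x \<beta>"
  by (cases \<beta>) (simp_all add: r_fun_def Dx_def r_var_def u_xt_def vfield_minus)

lemma D_r_var:
  assumes "\<beta> \<ge> 1"
  shows "Dy (r_var \<beta> a b) = r_var \<beta> (a + 1) b" "Dt (r_var \<beta> a b) = r_var \<beta> a (b + 1)"
    "Dx (r_var \<beta> a b) =
       (Dy ^^ a) ((Dt ^^ b) (u_x * Dx (r_fun (\<beta> - 1)) - Dy (r_fun (\<beta> - 1))))"
    "Dz (r_var \<beta> a b) =
       (Dy ^^ a) ((Dt ^^ b) (u_z * Dx (r_fun (\<beta> - 1)) - Dt (r_fun (\<beta> - 1))))"
proof -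
  obtain \<gamma> where \<gamma>: "\<beta> = Suc \<gamma>" using assms by (cases \<beta>) auto
  show "Dx (r_var \<beta> a b) =
       (Dy ^^ a) ((Dt ^^ b) (u_x * Dx (r_fun (\<beta> - 1)) - Dy (r_fun (\<beta> - 1))))"
    unfolding Dx_r_fun by (simp add: \<gamma> Dx_def r_var_def)
qed (use assms in \<open>simp_all add: Dy_def Dt_def Dz_def r_var_def\<close>)


section \<open>Symmetries and recursion operators\<close>

text \<open>
  A sequence \<open>[p_0, p_0^q, p_0^m, p_1^r, p_1^q, p_1^m, ...]\<close> is a function on \<open>nat\<close>, with \<open>p_0\<close> at
  place 0, \<open>p_\<beta>^r\<close> at place \<open>3\<beta>\<close>, \<open>p_\<alpha>^q\<close> at \<open>3\<alpha> + 1\<close> and \<open>p_\<alpha>^m\<close> at \<open>3\<alpha> + 2\<close>.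
\<close>

type_synonym aseq = "nat \<Rightarrow> alg"

definition p_zero :: "aseq \<Rightarrow> alg" where "p_zero P = P 0"
definition p_q :: "aseq \<Rightarrow> nat \<Rightarrow> alg" where "p_q P \<alpha> = P (3 * \<alpha> + 1)"
definition p_m :: "aseq \<Rightarrow> nat \<Rightarrow> alg" where "p_m P \<alpha> = P (3 * \<alpha> + 2)"
definition p_r :: "aseq \<Rightarrow> nat \<Rightarrow> alg" where "p_r P \<beta> = P (3 * \<beta>)"

definition make_seq :: "alg \<Rightarrow> (nat \<Rightarrow> alg) \<Rightarrow> (nat \<Rightarrow> alg) \<Rightarrow> (nat \<Rightarrow> alg) \<Rightarrow> aseq" where
  "make_seq p\<^sub>0 pq pm pr = (\<lambda>n. let k = n div 3 in
     if n = 0 then p\<^sub>0 else if n mod 3 = 1 then pq k else if n mod 3 = 2 then pm k else pr k)"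

lemma make_seq_simps:
  "p_zero (make_seq p\<^sub>0 pq pm pr) = p\<^sub>0"
  "p_q (make_seq p\<^sub>0 pq pm pr) \<alpha> = pq \<alpha>"
  "p_m (make_seq p\<^sub>0 pq pm pr) \<alpha> = pm \<alpha>"
  "\<beta> \<ge> 1 \<Longrightarrow> p_r (make_seq p\<^sub>0 pq pm pr) \<beta> = pr \<beta>"
proof -
  have "(3 * \<alpha> + 1) div 3 = \<alpha>" "(3 * \<alpha> + 1) mod 3 = 1"
    "(3 * \<alpha> + 2) div 3 = \<alpha>" "(3 * \<alpha> + 2) mod 3 = 2" by presburger+
  then show "p_q (make_seq p\<^sub>0 pq pm pr) \<alpha> = pq \<alpha>" "p_m (make_seq p\<^sub>0 pq pm pr) \<alpha> = pm \<alpha>"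
    unfolding p_q_def p_m_def make_seq_def Let_def by simp_all
qed (simp_all add: p_zero_def p_r_def make_seq_def)

definition tau_sym :: "aseq set" where
  "tau_sym = {P.
     Dy (Dz (p_zero P)) - Dt (Dx (p_zero P)) + u_z * Dx (Dx (p_zero P)) - u_x * Dx (Dz (p_zero P))
       + u_xt 2 0 * Dz (p_zero P) - u_xzt 1 1 0 * Dx (p_zero P) = 0 \<and>
     (\<forall>\<alpha>.
       Dt (p_q P \<alpha>) - u_z * Dx (p_q P \<alpha>) - Dx (q_var \<alpha> 0 0) * Dz (p_zero P)
         - Dz (prev (p_q P) \<alpha>) = 0 \<and>
       Dy (p_q P \<alpha>) - u_x * Dx (p_q P \<alpha>) - Dx (q_var \<alpha> 0 0) * Dx (p_zero P)
         - Dx (prev (p_q P) \<alpha>) = 0 \<and>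
       Dt (p_m P \<alpha>) - u_z * Dx (p_m P \<alpha>) - Dx (m_var \<alpha> 0 0) * Dz (p_zero P)
         + z_var * inv_t * Dz (p_m P \<alpha>) + inv_t * Dz (prev (p_m P) \<alpha>) = 0 \<and>
       Dy (p_m P \<alpha>) - u_x * Dx (p_m P \<alpha>) - Dx (m_var \<alpha> 0 0) * Dx (p_zero P)
         + z_var * inv_t * Dx (p_m P \<alpha>) + inv_t * Dx (prev (p_m P) \<alpha>) = 0) \<and>
     Dx (p_r P 1) - Dy (p_zero P) + 2 * u_x * Dx (p_zero P) = 0 \<and>
     Dz (p_r P 1) - Dt (p_zero P) + u_x * Dz (p_zero P) + u_z * Dx (p_zero P) = 0 \<and>
     (\<forall>\<beta>\<ge>2.
       Dx (p_r P \<beta>) - u_x * Dx (p_r P (\<beta> - 1)) - Dx (r_fun (\<beta> - 1)) * Dx (p_zero P)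
         + Dy (p_r P (\<beta> - 1)) = 0 \<and>
       Dz (p_r P \<beta>) - u_z * Dx (p_r P (\<beta> - 1)) - Dx (r_fun (\<beta> - 1)) * Dz (p_zero P)
         + Dt (p_r P (\<beta> - 1)) = 0)}"

definition real_scale :: "real \<Rightarrow> aseq \<Rightarrow> aseq" where "real_scale k P = (\<lambda>n. k *\<^sub>R P n)"

definition alg_scale :: "alg \<Rightarrow> aseq \<Rightarrow> aseq" where "alg_scale a P = (\<lambda>n. a * P n)"

definition recursion_operator :: "(aseq \<Rightarrow> aseq) \<Rightarrow> bool" where
  "recursion_operator R \<longleftrightarrow>
     Vector_Spaces.linear real_scale real_scale R \<and> (\<forall>P\<in>tau_sym. R P \<in> tau_sym)"

definition Rq :: "aseq \<Rightarrow> aseq" where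
  "Rq P = make_seq
     (u_x * p_zero P + p_r P 1)
     (\<lambda>\<alpha>. Dx (q_var \<alpha> 0 0) * p_zero P + prev (p_q P) \<alpha>)
     (\<lambda>\<alpha>. Dx (m_var \<alpha> 0 0) * p_zero P - inv_t * prev (p_m P) \<alpha> - z_var * inv_t * p_m P \<alpha>)
     (\<lambda>\<beta>. Dx (r_fun \<beta>) * p_zero P - p_r P (\<beta> + 1))"

definition Rm :: "aseq \<Rightarrow> aseq" where
  "Rm P = alg_scale t_var (Rq P) + alg_scale z_var (id P)"

end

theory Submission
  imports Defs
begin

text \<open>
  In each equation for \<open>Rm P\<close>, the equations for \<open>P\<close> eliminate the derivatives of its components
  as far as possible, and the terms that remain cancel because \<open>u_x\<close>, \<open>q_{\<alpha>,x}\<close>, \<open>m_{\<alpha>,x}\<close>,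
  \<open>r_{\<beta>,x}\<close> satisfy differentiated forms of the covering equations. All of this needs the total
  derivatives to commute. Mixed partial derivatives being symmetric, two vector fields commute as
  soon as they do so on the coordinates. For many coordinates that is immediate from the definition;
  the others are reduced to pairs of fields already known to commute, at least on functions not
  involving the coordinates \<open>u_{x^i y^k t^j}\<close> and \<open>r\<close>, so the order in which the pairs are treated
  matters. Only \<open>Dy\<close>, \<open>Dt\<close> on \<open>q\<close>, \<open>m\<close> and \<open>Dx\<close>, \<open>Dz\<close> on \<open>r\<close> depend on the explicit
  form of \<open>G\<close>.
\<close>

section \<open>Equality of mixed partial derivatives\<close>

text \<open>The mean value theorem is applied first to \<open>f x (b + h) - f x b\<close> as a
  function of \<open>x\<close>, then to \<open>f1 x\<close> on the interval from \<open>b\<close> to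
  \<open>b + h\<close>.\<close>

lemma second_difference:
  fixes f f1 f12 :: "real \<Rightarrow> real \<Rightarrow> real"
  assumes f1: "\<And>x y. ((\<lambda>x. f x y) has_real_derivative f1 x y) (at x)"
    and f12: "\<And>x y. ((\<lambda>y. f1 x y) has_real_derivative f12 x y) (at y)"
    and h: "h > 0"
  shows "\<exists>x y. a < x \<and> x < a + h \<and> b < y \<and> y < b + h \<and>
    f (a + h) (b + h) - f (a + h) b - f a (b + h) + f a b = h * h * f12 x y"
proof -
  have "\<exists>x>a. x < a + h \<and> (f (a + h) (b + h) - f (a + h) b) - (f a (b + h) - f a b)
      = (a + h - a) * (f1 x (b + h) - f1 x b)"
    by (rule MVT2) (use h in \<open>auto intro: DERIV_diff f1\<close>)
  then obtain x where x: "a < x" "x < a + h"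
    "f (a + h) (b + h) - f (a + h) b - (f a (b + h) - f a b) = h * (f1 x (b + h) - f1 x b)"
    by auto
  have "\<exists>y>b. y < b + h \<and> f1 x (b + h) - f1 x b = (b + h - b) * f12 x y"
    by (rule MVT2) (use h f12 in auto)
  then obtain y where y: "b < y" "y < b + h" "f1 x (b + h) - f1 x b = h * f12 x y"
    by auto
  show ?thesis using x y by (auto simp: algebra_simps)
qed

text \<open>The second difference over a square of side \<open>h\<close> is symmetric in the two
  variables. Divided by \<open>h * h\<close>, it is therefore both a value of \<open>f12\<close> and
  a value of \<open>f21\<close> inside the square, and both values converge to those at the corner
  as \<open>h\<close> tends to 0.\<close>

lemma mixed_derivatives_eq:
  fixes f f1 f2 f12 f21 :: "real \<Rightarrow> real \<Rightarrow> real"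
  assumes f1: "\<And>x y. ((\<lambda>x. f x y) has_real_derivative f1 x y) (at x)"
    and f12: "\<And>x y. ((\<lambda>y. f1 x y) has_real_derivative f12 x y) (at y)"
    and f2: "\<And>x y. ((\<lambda>y. f x y) has_real_derivative f2 x y) (at y)"
    and f21: "\<And>x y. ((\<lambda>x. f2 x y) has_real_derivative f21 x y) (at x)"
    and cont: "isCont (\<lambda>z. f12 (fst z) (snd z)) (a, b)" "isCont (\<lambda>z. f21 (fst z) (snd z)) (a, b)"
  shows "f12 a b = f21 a b"
proof -
  define h :: "nat \<Rightarrow> real" where "h n = inverse (real (Suc n))" for n
  have hpos: "h n > 0" for n by (simp add: h_def)
  have h0: "h \<longlonglongrightarrow> 0" unfolding h_def by (rule LIMSEQ_inverse_real_of_nat)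
  have squeeze: "s \<longlonglongrightarrow> e" if "\<And>n. e < s n" "\<And>n. s n < e + h n" for s e
  proof (rule tendsto_sandwich[of "\<lambda>_. e" s sequentially "\<lambda>n. e + h n"])
    show "(\<lambda>n. e + h n) \<longlonglongrightarrow> e" using tendsto_add[OF tendsto_const[of e] h0] by simp
  qed (use that in \<open>auto intro!: always_eventually less_imp_le\<close>)
  have "\<exists>x y x' y'. a < x \<and> x < a + h n \<and> b < y \<and> y < b + h n \<and>
      a < x' \<and> x' < a + h n \<and> b < y' \<and> y' < b + h n \<and> f12 x y = f21 x' y'" for n
  proof -
    obtain x y where xy: "a < x" "x < a + h n" "b < y" "y < b + h n"
      "f (a + h n) (b + h n) - f (a + h n) b - f a (b + h n) + f a b = h n * h n * f12 x y"
      using second_difference[OF f1 f12 hpos, of a n b] by auto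
    \<comment> \<open>Here the variables exchange roles, so the first difference is taken in
      \<open>y\<close>.\<close>
    obtain y' x' where xy': "a < x'" "x' < a + h n" "b < y'" "y' < b + h n"
      "f (a + h n) (b + h n) - f a (b + h n) - f (a + h n) b + f a b = h n * h n * f21 x' y'"
      using second_difference[OF f2 f21 hpos, of b n a] by auto
    have "h n * h n * f12 x y = h n * h n * f21 x' y'" using xy(5) xy'(5) by linarith
    then have "f12 x y = f21 x' y'" using hpos[of n] by simp
    then show ?thesis using xy xy' by blast
  qed
  then obtain x y x' y' where
    xy: "\<And>n. a < x n" "\<And>n. x n < a + h n" "\<And>n. b < y n" "\<And>n. y n < b + h n"
      "\<And>n. a < x' n" "\<And>n. x' n < a + h n" "\<And>n. b < y' n" "\<And>n. y' n < b + h n"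
    and eq: "\<And>n. f12 (x n) (y n) = f21 (x' n) (y' n)"
    by metis
  have "(\<lambda>n. (x n, y n)) \<longlonglongrightarrow> (a, b)" "(\<lambda>n. (x' n, y' n)) \<longlonglongrightarrow> (a, b)"
    by (intro tendsto_Pair squeeze xy)+
  then have "(\<lambda>n. f12 (x n) (y n)) \<longlonglongrightarrow> f12 a b" "(\<lambda>n. f21 (x' n) (y' n)) \<longlonglongrightarrow> f21 a b"
    using isCont_tendsto_compose[OF cont(1)] isCont_tendsto_compose[OF cont(2)] by fastforce+
  then show ?thesis using eq LIMSEQ_unique by simp
qed

lemma smooth_partial_commute:
  assumes "smooth f" shows "partial c (partial d f) = partial d (partial c f)"
proof (cases "c = d")
  case False
  have D: "((\<lambda>s. g (p(e := s))) has_real_derivative partial e g (p(e := r))) (at r)"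
    if "smooth g" for g e p r
  proof -
    have "(\<lambda>s. g ((p(e := r))(e := s))) field_differentiable at ((p(e := r)) e)"
      using that unfolding smooth_def by (metis foldr_Nil id_apply)
    then show ?thesis by (simp add: partial_def DERIV_deriv_iff_field_differentiable)
  qed
  \<comment> \<open>The plane through \<open>p\<close> in the directions \<open>c\<close> and
    \<open>d\<close> embeds continuously into the product space, since each coordinate of the
    embedding is continuous.\<close>
  have cont: "isCont (\<lambda>z. g (p(c := fst z, d := snd z))) (x, y)" if "smooth g" for g p x y
  proof -
    have "continuous_on UNIV (\<lambda>z::real \<times> real. (p(c := fst z, d := snd z)) e)" for e
      by (cases "e = d"; cases "e = c") (auto intro!: continuous_intros)
    then have "continuous_on UNIV (\<lambda>z::real \<times> real. p(c := fst z, d := snd z))"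
      by (rule continuous_on_coordinatewise_then_product)
    moreover have "continuous_on UNIV g"
      using that unfolding smooth_def by (metis foldr_Nil id_apply)
    ultimately have "continuous_on UNIV (g \<circ> (\<lambda>z. p(c := fst z, d := snd z)))"
      by (meson continuous_on_compose continuous_on_subset subset_UNIV)
    then show ?thesis by (simp add: o_def continuous_on_eq_continuous_at)
  qed
  show ?thesis
  proof
    fix p :: pt
    define E where "E x y = p(c := x, d := y)" for x y :: real
    have E: "E x y = (p(c := x))(d := y)" "E x y = (p(d := y))(c := x)" for x y
      using False by (auto simp: E_def fun_upd_twist)
    have "partial d (partial c f) (E (p c) (p d)) = partial c (partial d f) (E (p c) (p d))"
    proof (rule mixed_derivatives_eq[where f = "\<lambda>x y. f (E x y)"
          and ?f1.0 = "\<lambda>x y. partial c f (E x y)" and ?f2.0 = "\<lambda>x y. partial d f (E x y)"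
          and ?f12.0 = "\<lambda>x y. partial d (partial c f) (E x y)"
          and ?f21.0 = "\<lambda>x y. partial c (partial d f) (E x y)"])
      show "((\<lambda>x. f (E x y)) has_real_derivative partial c f (E x y)) (at x)" for x y
        unfolding E(2) by (rule D[OF assms])
      show "((\<lambda>y. f (E x y)) has_real_derivative partial d f (E x y)) (at y)" for x y
        unfolding E(1) by (rule D[OF assms])
      show "((\<lambda>y. partial c f (E x y)) has_real_derivative partial d (partial c f) (E x y)) (at y)"
        for x y
        unfolding E(1) by (rule D[OF smooth_partial[OF assms]])
      show "((\<lambda>x. partial d f (E x y)) has_real_derivative partial c (partial d f) (E x y)) (at x)"
        for x y
        unfolding E(2) by (rule D[OF smooth_partial[OF assms]])
    qed (unfold E_def, (intro cont smooth_partial assms)+)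
    moreover have "E (p c) (p d) = p" by (simp add: E_def)
    ultimately show "partial c (partial d f) p = partial d (partial c f) p" by simp
  qed
qed simp


section \<open>Commutators of vector fields\<close>

lemma pd_0: "pd c 0 = 0"
  using pd_add[of c 0 0] by simp

lemma pd_1: "pd c 1 = 0"
  using pd_mult[of c 1 1] by simp

lemma pd_minus: "pd c (- f) = - pd c f"
  using pd_add[of c f "- f"] by (simp add: pd_0 add_eq_0_iff)

text \<open>Differentiate \<open>var c * inv_var c = 1\<close> and multiply by
  \<open>inv_var c\<close>.\<close>

lemma pd_inv_var: "pd d (inv_var c) = - (pd d (var c) * (inv_var c * inv_var c))"
proof -
  have "inv_var c * pd d (var c * inv_var c) = 0" by (simp add: var_inv_var pd_1)
  then have "(var c * inv_var c) * pd d (inv_var c) + pd d (var c) * (inv_var c * inv_var c) = 0"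
    by (simp add: pd_mult algebra_simps)
  then show ?thesis by (simp add: var_inv_var add_eq_0_iff)
qed

text \<open>Every class has a representative in \<open>gen_alg\<close>, which is built from these
  generators by sums and products. Identities between derivations thus need to be checked on
  generators only.\<close>

lemma alg_induct [case_names const var inv_var smooth add mult]:
  assumes const: "\<And>k. P (abs_alg (\<lambda>_. k))"
    and var: "\<And>c. P (var c)"
    and inv_var: "\<And>c. P (inv_var c)"
    and smooth: "\<And>f. smooth f \<Longrightarrow> P (abs_alg f)"
    and add: "\<And>f g. P f \<Longrightarrow> P g \<Longrightarrow> P (f + g)"
    and mult: "\<And>f g. P f \<Longrightarrow> P g \<Longrightarrow> P (f * g)"
  shows "P a"
proof -
  have add_abs: "abs_alg (\<lambda>p. f p + g p) = abs_alg f + abs_alg g"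
    and mult_abs: "abs_alg (\<lambda>p. f p * g p) = abs_alg f * abs_alg g"
    if "f \<in> gen_alg" "g \<in> gen_alg" for f g
    using that by (simp_all add: plus_alg.abs_eq times_alg.abs_eq eq_onp_same_args in_alg_gen)
  have laurent_gen: "f \<in> laurent \<Longrightarrow> P (abs_alg f)" for f
  proof (induction rule: laurent.induct)
    case (const k) then show ?case by (rule assms)
  next
    case (coord c) then show ?case using var[of c] by (simp add: var.abs_eq)
  next
    case (inv_coord c) then show ?case using inv_var[of c] by (simp add: inv_var.abs_eq)
  next
    case (add f g) then show ?case using assms(5) by (simp add: add_abs gen_alg.laurent)
  next
    case (mult f g) then show ?case using assms(6) by (simp add: mult_abs gen_alg.laurent)
  qed
  have gen: "f \<in> gen_alg \<Longrightarrow> P (abs_alg f)" for f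
    by (induction rule: gen_alg.induct) (auto simp: laurent_gen add_abs mult_abs assms)
  show ?thesis
  proof (induction a rule: alg.abs_induct)
    fix f assume f: "in_alg f \<and> in_alg f \<and> agree f f"
    then obtain g where g: "g \<in> gen_alg" "agree f g" unfolding in_alg_def by blast
    then have "abs_alg f = abs_alg g"
      using f Quotient3_rel[OF Quotient3_alg, of f g] by (simp add: in_alg_gen)
    then show "P (abs_alg f)" using gen[OF g(1)] by simp
  qed
qed

text \<open>By the Leibniz rule the property passes to sums and products. The analytic content lies
  in the smooth generators, where \<open>smooth_partial_commute\<close> applies.\<close>

lemma pd_commute: "pd c (pd d f) = pd d (pd c f)"
proof (induction f rule: alg_induct)
  case (const k)
  have "partial e (\<lambda>_. k) = (\<lambda>_. 0)" for e by (simp add: partial_def)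
  then have "pd e (abs_alg (\<lambda>_. k)) = 0" for e
    by (simp add: pd.abs_eq zero_alg_def)
  then show ?case by (simp add: pd_0)
next
  case (var e)
  then show ?case by (simp add: pd_var pd_0 pd_1)
next
  case (inv_var e)
  have "pd a (pd b (inv_var e)) = (if a = e \<and> b = e then 2 * inv_var e * inv_var e * inv_var e else 0)"
    for a b
    by (simp add: pd_inv_var pd_var pd_0 pd_1 pd_minus pd_mult algebra_simps)
  then show ?case by simp
next
  case (smooth f)
  then show ?case
    by (simp add: pd.abs_eq in_alg_gen gen_alg.smooth smooth_partial smooth_partial_commute[of f c d])
qed (simp_all add: pd_add pd_mult algebra_simps)

lemma only_on_UNIV: "only_on UNIV f"
  by transfer (metis agree_refl depends_on_def UNIV_I ext)

lemma vfield_0: "vfield a 0 = 0"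
  using vfield_add[of a 0 0] by simp

lemma vfield_sum: "vfield a (sum h K) = (\<Sum>c\<in>K. vfield a (h c))"
  by (induction K rule: infinite_finite_induct) (simp_all add: vfield_0 vfield_add)

text \<open>The second-order parts of the two compositions coincide by \<open>pd_commute\<close>, so
  the commutator is again a vector field, with components
  \<open>vfield a (b c) - vfield b (a c)\<close>. The set \<open>J\<close> allows the test to be
  confined to the coordinates that \<open>f\<close> involves.\<close>

lemma vfield_commute:
  assumes "only_on J f" "\<And>c. c \<in> J \<Longrightarrow> vfield a (b c) = vfield b (a c)"
  shows "vfield a (vfield b f) = vfield b (vfield a f)"
proof -
  define K where "K = {c. pd c f \<noteq> 0}"
  have K: "finite K" by (simp add: K_def finite_pd_nonzero)
  have "{d. pd d (pd c f) \<noteq> 0} \<subseteq> K" for c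
    by (auto simp: K_def pd_commute[of _ c] pd_0)
  then have pd_f: "vfield e (pd c f) = (\<Sum>d\<in>K. e d * pd d (pd c f))" for e c
    by (rule vfield_eq[OF K])
  \<comment> \<open>The first sum is the first-order part of the composition, the second its
    second-order part.\<close>
  have twice: "vfield e (vfield e' f) =
      (\<Sum>c\<in>K. vfield e (e' c) * pd c f) + (\<Sum>c\<in>K. \<Sum>d\<in>K. e' c * e d * pd d (pd c f))" for e e'
    by (simp add: vfield_eq[OF K, of f] K_def[symmetric] vfield_sum vfield_mult pd_f sum.distrib
        sum_distrib_left algebra_simps)
  have "(\<Sum>c\<in>K. \<Sum>d\<in>K. b c * a d * pd d (pd c f)) = (\<Sum>c\<in>K. \<Sum>d\<in>K. a c * b d * pd d (pd c f))"
    by (subst sum.swap) (simp add: pd_commute mult.commute)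
  moreover have "vfield a (b c) = vfield b (a c)" if "c \<in> K" for c
    using assms pd_only_on that unfolding K_def by blast
  ultimately show ?thesis by (simp add: twice)
qed


section \<open>Total derivatives commute\<close>

lemma vfield_1: "vfield a 1 = 0"
  using vfield_mult[of a 1 1] by simp

lemma vfield_diff: "vfield a (f - g) = vfield a f - vfield a g"
  using vfield_add[of a f "- g"] by (simp add: vfield_minus)

lemma vfield_inv_var: "vfield a (inv_var c) = - (a c * (inv_var c * inv_var c))"
proof -
  have "inv_var c * vfield a (var c * inv_var c) = 0" by (simp add: var_inv_var vfield_1)
  then have "(var c * inv_var c) * vfield a (inv_var c) + a c * (inv_var c * inv_var c) = 0"
    by (simp add: vfield_mult algebra_simps)
  then show ?thesis by (simp add: var_inv_var add_eq_0_iff)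
qed

lemmas vfield_rules = vfield_0 vfield_1 vfield_add vfield_diff vfield_minus vfield_mult

lemmas D_rules = vfield_rules[of Dx_comp, folded Dx_def] vfield_rules[of Dy_comp, folded Dy_def]
  vfield_rules[of Dz_comp, folded Dz_def] vfield_rules[of Dt_comp, folded Dt_def]

lemma D_inv_t: "Dx inv_t = 0" "Dy inv_t = 0" "Dz inv_t = 0" "Dt inv_t = - (inv_t * inv_t)"
  by (simp_all add: Dx_def Dy_def Dz_def Dt_def vfield_inv_var)

text \<open>The cases use the unshifted indices in which the rules of \<open>D_coord\<close> are
  stated. Membership in \<open>base_coords\<close> is recorded so that these cases drop out where
  \<open>c\<close> is assumed to lie outside.\<close>

lemma coord_cases:
  obtains "c \<in> {CX, CY, CZ, CT}"
  | i j where "var c = u_xt i j"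
  | i k j where "k \<ge> 1" "var c = u_xyt i k j"
  | i l j where "c \<in> base_coords" "l \<ge> 1" "var c = u_xzt i l j"
  | \<alpha> a b where "c \<in> base_coords" "var c = q_var \<alpha> a b"
  | \<alpha> a b where "c \<in> base_coords" "var c = m_var \<alpha> a b"
  | \<beta> a b where "\<beta> \<ge> 1" "var c = r_var \<beta> a b"
proof (cases c)
  case (CUY i k j) then show ?thesis using that(3)[of "Suc k" i j] by (simp add: u_xyt_def)
next
  case (CUZ i l j) then show ?thesis using that(4)[of "Suc l" i j] by (simp add: u_xzt_def)
next
  case (CR \<beta> a b) then show ?thesis using that(7)[of "Suc \<beta>" a b] by (simp add: r_var_def)
qed (use that in \<open>auto simp: u_xt_def q_var_def m_var_def\<close>)

lemmas D_coord = D_base D_u_xt D_u_xyt D_u_xzt D_q_var D_m_var D_r_var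

text \<open>This pair commutes on every coordinate by definition: \<open>Dx\<close> is the outermost
  operator in the components of \<open>Dy\<close> along \<open>CUZ\<close>, \<open>CQ\<close>,
  \<open>CM\<close>, and \<open>Dy\<close> is outermost in those of \<open>Dx\<close> along
  \<open>CR\<close>.\<close>

lemma Dx_Dy_commute: "Dx (Dy f) = Dy (Dx f)"
proof -
  have "Dx (Dy (var c)) = Dy (Dx (var c))" for c
    by (cases c rule: coord_cases) (auto simp: D_coord D_rules)
  then show ?thesis
    using vfield_commute[OF only_on_UNIV, of Dx_comp Dy_comp] by (simp add: Dx_def Dy_def)
qed

lemma base_coord_cases:
  assumes "c \<in> base_coords"
  obtains "c \<in> {CX, CY, CZ, CT}"
  | i j where "var c = u_xt i j"
  | i l j where "l \<ge> 1" "var c = u_xzt i l j"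
  | \<alpha> a b where "var c = q_var \<alpha> a b"
  | \<alpha> a b where "var c = m_var \<alpha> a b"
  using assms
proof (cases rule: base_coords_cases)
  case (3 i l j) then show ?thesis using that(3)[of "Suc l" i j] by (simp add: u_xzt_def)
qed (use that in \<open>auto simp: u_xt_def q_var_def m_var_def\<close>)

section \<open>Commutation on functions of the base coordinates\<close>

lemma based_Dx: "based f \<Longrightarrow> based (Dx f)"
  using based_Dx0 Dx0_eq by metis

lemma based_Dz: "based f \<Longrightarrow> based (Dz f)"
  using based_Dz0 Dz0_eq by metis

lemma based_funpow: "(\<And>f. based f \<Longrightarrow> based (D f)) \<Longrightarrow> based f \<Longrightarrow> based ((D ^^ n) f)"
  by (induction n) auto

text \<open>Closure under \<open>E\<close> alone is assumed, so \<open>D\<close> may be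
  \<open>Dy\<close>, which leads out of the based functions.\<close>

lemma funpow_commute_on:
  assumes "\<And>f. P f \<Longrightarrow> D (E f) = E (D f)" "\<And>f. P f \<Longrightarrow> P (E f)" "P f"
  shows "D ((E ^^ n) f) = (E ^^ n) (D f)"
proof (induction n)
  case (Suc n)
  have "P ((E ^^ n) f)" using assms(2,3) by (induction n) auto
  then show ?case using Suc assms(1) by simp
qed simp

lemma Dx_Dz_commute_based:
  assumes "based f" shows "Dx (Dz f) = Dz (Dx f)"
proof -
  have "Dx (Dz (var c)) = Dz (Dx (var c))" if "c \<in> base_coords" for c
    using that by (cases rule: base_coord_cases) (auto simp: D_coord D_rules)
  then show ?thesis
    using vfield_commute[OF assms, of Dx_comp Dz_comp] by (simp add: Dx_def Dz_def)
qed

lemma Dz_Dx_pow_based: "based f \<Longrightarrow> Dz ((Dx ^^ n) f) = (Dx ^^ n) (Dz f)"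
  by (rule funpow_commute_on[of based]) (auto simp: Dx_Dz_commute_based intro: based_Dx)

lemmas based_pow = based_funpow[of Dx, OF based_Dx] based_funpow[of Dz, OF based_Dz] based_Dt_pow

lemma Dx_Dt_commute_based:
  assumes "based f" shows "Dx (Dt f) = Dt (Dx f)"
proof -
  have "Dx (Dt (var c)) = Dt (Dx (var c))" if "c \<in> base_coords" for c
    using that by (cases rule: base_coord_cases) (auto simp: D_coord D_rules)
  then show ?thesis
    using vfield_commute[OF assms, of Dx_comp Dt_comp] by (simp add: Dx_def Dt_def)
qed

text \<open>On \<open>q_var \<alpha> a b\<close> and \<open>m_var \<alpha> a b\<close> the index
  \<open>b\<close> sits inside \<open>Dx ^^ a\<close>, so \<open>Dz\<close> must first be moved past
  these powers.\<close>

lemma Dz_Dt_commute_based: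
  assumes "based f" shows "Dz (Dt f) = Dt (Dz f)"
proof -
  have "Dz (Dt (var c)) = Dt (Dz (var c))" if "c \<in> base_coords" for c
    using that by (cases rule: base_coord_cases)
      (auto simp: D_coord D_rules Dz_Dx_pow_based based_intros based_pow)
  then show ?thesis
    using vfield_commute[OF assms, of Dz_comp Dt_comp] by (simp add: Dz_def Dt_def)
qed

lemma Dy_Dz_commute_based:
  assumes "based f" shows "Dy (Dz f) = Dz (Dy f)"
proof -
  have "Dy (Dz (var c)) = Dz (Dy (var c))" if "c \<in> base_coords" for c
    using that
  proof (cases rule: base_coord_cases)
    case (3 i l j)
    \<comment> \<open>This removes the truncated subtraction \<open>l - 1\<close> from the rule for
      \<open>Dy (u_xzt i l j)\<close>.\<close>
    then obtain k where "l = Suc k" by (cases l) auto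
    then show ?thesis
      using 3 by (simp add: D_coord Dz_Dx_pow_based based_G based_pow)
  qed (auto simp: D_coord D_rules Dz_Dx_pow_based based_intros based_pow)
  then show ?thesis
    using vfield_commute[OF assms, of Dy_comp Dz_comp] by (simp add: Dy_def Dz_def)
qed

lemma Dy_pow_based:
  assumes "based f" shows "Dy ((Dx ^^ a) ((Dz ^^ b) f)) = (Dx ^^ a) ((Dz ^^ b) (Dy f))"
  using funpow_commute_on[of based Dy Dz f, OF Dy_Dz_commute_based based_Dz assms]
    funpow_commute_on[of "\<lambda>_. True" Dy Dx] Dx_Dy_commute by simp

lemma Dt_pow_based:
  assumes "based f" shows "Dt ((Dx ^^ a) ((Dz ^^ b) f)) = (Dx ^^ a) ((Dz ^^ b) (Dt f))"
proof -
  have "Dt ((Dx ^^ a) ((Dz ^^ b) f)) = (Dx ^^ a) (Dt ((Dz ^^ b) f))"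
    by (rule funpow_commute_on[of based])
      (auto simp: Dx_Dt_commute_based assms based_pow intro: based_Dx)
  moreover have "Dt ((Dz ^^ b) f) = (Dz ^^ b) (Dt f)"
    by (rule funpow_commute_on[of based])
      (auto simp: Dz_Dt_commute_based assms intro: based_Dz)
  ultimately show ?thesis by simp
qed

text \<open>Compatibility of the two covering equations for \<open>q\<close>: the coefficient of
  \<open>q_var \<alpha> 1 0\<close> cancels because \<open>Dy u_z = G\<close>. Indices down to
  \<alpha> - 2 occur, hence the double case distinction.\<close>

lemma Dy_Dt_q: "Dy (Dt (q_var \<alpha> 0 0)) = Dt (Dy (q_var \<alpha> 0 0))"
  by (cases \<alpha>; cases "\<alpha> - 1")
    (simp_all add: D_coord D_rules prev_def G_def numeral_2_eq_2 algebra_simps)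

lemma Dy_Dt_m: "Dy (Dt (m_var \<alpha> 0 0)) = Dt (Dy (m_var \<alpha> 0 0))"
  by (cases \<alpha>; cases "\<alpha> - 1")
    (simp_all add: D_coord D_rules D_inv_t prev_def G_def numeral_2_eq_2 algebra_simps)

text \<open>On \<open>q\<close> and \<open>m\<close> both fields are moved inside
  \<open>Dx ^^ a\<close> and \<open>Dz ^^ b\<close>, which leaves the case a = b = 0 just
  treated.\<close>

lemma Dy_Dt_commute: "Dy (Dt f) = Dt (Dy f)"
proof -
  have "Dy (Dt (var c)) = Dt (Dy (var c))" for c
  proof (cases c rule: coord_cases)
    case (4 i l j)
    then show ?thesis by (simp add: D_coord Dt_pow_based based_G based_pow)
  next
    case (5 \<alpha> a b)
    then show ?thesis using Dy_Dt_q[of \<alpha>]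
      by (simp add: D_coord Dt_pow_based Dy_pow_based based_intros del: One_nat_def)
  next
    case (6 \<alpha> a b)
    then show ?thesis using Dy_Dt_m[of \<alpha>]
      by (simp add: D_coord Dt_pow_based Dy_pow_based based_intros del: One_nat_def)
  qed (auto simp: D_coord D_rules)
  then show ?thesis
    using vfield_commute[OF only_on_UNIV, of Dy_comp Dt_comp] by (simp add: Dy_def Dt_def)
qed

section \<open>Commutation of the remaining pairs on all functions\<close>

lemma funpow_commute: "(\<And>f. D (E f) = E (D f)) \<Longrightarrow> D ((E ^^ n) f) = (E ^^ n) (D f)"
  by (rule funpow_commute_on[of "\<lambda>_. True"]) auto

lemma Dx_Dt_commute: "Dx (Dt f) = Dt (Dx f)"
proof -
  have "Dx (Dt (var c)) = Dt (Dx (var c))" for c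
    by (cases c rule: coord_cases)
      (auto simp: D_coord D_rules funpow_commute[of Dt Dy, OF Dy_Dt_commute[symmetric]])
  then show ?thesis
    using vfield_commute[OF only_on_UNIV, of Dx_comp Dt_comp] by (simp add: Dx_def Dt_def)
qed

lemma Dy_Dz_commute: "Dy (Dz f) = Dz (Dy f)"
proof -
  have "Dy (Dz (var c)) = Dz (Dy (var c))" for c
  proof (cases "c \<in> base_coords")
    case True
    then show ?thesis by (intro Dy_Dz_commute_based only_on_var)
  next
    case False
    then show ?thesis
    proof (cases c rule: coord_cases)
      case (3 i k j)
      then obtain l where "k = Suc l" by (cases k) auto
      then show ?thesis
        using 3 by (simp add: D_coord funpow_commute[of Dy Dx, OF Dx_Dy_commute[symmetric]])
    qed (auto simp: D_coord D_rules)
  qed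
  then show ?thesis
    using vfield_commute[OF only_on_UNIV, of Dy_comp Dz_comp] by (simp add: Dy_def Dz_def)
qed

lemma Dz_Dt_commute: "Dz (Dt f) = Dt (Dz f)"
proof -
  have "Dz (Dt (var c)) = Dt (Dz (var c))" for c
  proof (cases "c \<in> base_coords")
    case True
    then show ?thesis by (intro Dz_Dt_commute_based only_on_var)
  next
    case False
    then show ?thesis
      by (cases c rule: coord_cases)
        (auto simp: D_coord D_rules funpow_commute[of Dt Dx, OF Dx_Dt_commute[symmetric]]
          funpow_commute[of Dt Dy, OF Dy_Dt_commute[symmetric]])
  qed
  then show ?thesis
    using vfield_commute[OF only_on_UNIV, of Dz_comp Dt_comp] by (simp add: Dz_def Dt_def)
qed

lemma D_r_fun_Suc:
  "Dx (r_fun (Suc \<beta>)) = u_x * Dx (r_fun \<beta>) - Dy (r_fun \<beta>)"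
  "Dz (r_fun (Suc \<beta>)) = u_z * Dx (r_fun \<beta>) - Dt (r_fun \<beta>)"
  by (simp_all add: r_fun_def[of "Suc \<beta>"] D_r_var)

text \<open>The second conjunct is the compatibility condition of the equations defining \<open>r_(\<beta>+1)\<close>.\<close>

lemma r_fun_equation:
  "Dx (Dz (r_fun \<beta>)) = Dz (Dx (r_fun \<beta>)) \<and>
   Dy (Dz (r_fun \<beta>)) - Dt (Dx (r_fun \<beta>)) + u_z * Dx (Dx (r_fun \<beta>)) - u_x * Dx (Dz (r_fun \<beta>)) = 0"
proof (induction \<beta>)
  case 0
  \<comment> \<open>For r_0 = -u the second conjunct is the equation for u with its sign
    reversed.\<close>
  then show ?case
    by (simp add: r_fun_def D_rules D_coord G_def numeral_2_eq_2 algebra_simps)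
next
  case (Suc \<beta>)
  \<comment> \<open>Expanded by \<open>D_r_fun_Suc\<close>, this is the second conjunct for \<beta>,
    once the first has been used to swap \<open>Dx\<close> and \<open>Dz\<close> on
    \<open>r_fun \<beta>\<close>.\<close>
  then have "Dx (Dz (r_fun (Suc \<beta>))) = Dz (Dx (r_fun (Suc \<beta>)))"
    by (simp add: D_r_fun_Suc D_rules D_coord Dx_Dt_commute Dy_Dz_commute algebra_simps)
  \<comment> \<open>In the second conjunct the coefficient of \<open>Dx (r_fun \<beta>)\<close>
    cancels by the form of \<open>G\<close>, and the other terms cancel in pairs.\<close>
  then show ?case
    by (simp add: D_r_fun_Suc D_rules D_coord G_def numeral_2_eq_2
        Dx_Dt_commute Dx_Dy_commute Dy_Dt_commute algebra_simps)
qed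

text \<open>On \<open>r_var \<beta> a b\<close> both fields pass through the powers of
  \<open>Dy\<close> and \<open>Dt\<close> by the commutation rules already proved, which reduces the
  claim to \<open>r_fun_equation\<close>.\<close>

lemma Dx_Dz_commute: "Dx (Dz f) = Dz (Dx f)"
proof -
  have "Dx (Dz (var c)) = Dz (Dx (var c))" for c
  proof (cases "c \<in> base_coords")
    case True
    then show ?thesis by (intro Dx_Dz_commute_based only_on_var)
  next
    case False
    then show ?thesis
    proof (cases c rule: coord_cases)
      case (7 \<beta> a b)
      then obtain \<gamma> where \<gamma>: "\<beta> = Suc \<gamma>" by (cases \<beta>) auto
      have pow: "Dx ((Dy ^^ a) ((Dt ^^ b) f)) = (Dy ^^ a) ((Dt ^^ b) (Dx f))"
        "Dz ((Dy ^^ a) ((Dt ^^ b) f)) = (Dy ^^ a) ((Dt ^^ b) (Dz f))" for f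
        by (simp_all add: funpow_commute Dx_Dt_commute Dx_Dy_commute Dy_Dz_commute Dz_Dt_commute)
      show ?thesis
        using 7 r_fun_equation[of \<beta>] by (simp add: D_r_var pow \<gamma> D_r_fun_Suc)
    qed (auto simp: D_coord D_rules)
  qed
  then show ?thesis
    using vfield_commute[OF only_on_UNIV, of Dx_comp Dz_comp] by (simp add: Dx_def Dz_def)
qed


section \<open>The recursion operator\<close>

lemma module_alg_scale: "module alg_scale"
  by unfold_locales (auto simp: alg_scale_def fun_eq_iff algebra_simps)

lemma Rm_add: "Rm (P + Q) = Rm P + Rm Q"
  by (simp add: fun_eq_iff Rm_def Rq_def make_seq_def alg_scale_def Let_def prev_def
      p_zero_def p_q_def p_m_def p_r_def algebra_simps)

lemma Rm_scale: "Rm (alg_scale a P) = alg_scale a (Rm P)"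
  by (simp add: fun_eq_iff Rm_def Rq_def make_seq_def alg_scale_def Let_def prev_def
      p_zero_def p_q_def p_m_def p_r_def algebra_simps)

lemma module_hom_Rm: "module_hom alg_scale alg_scale Rm"
  using module_alg_scale by (simp add: module_hom_iff Rm_add Rm_scale)

text \<open>Real linearity thereby becomes a special case of linearity over the algebra.\<close>

lemma real_scale_eq: "real_scale k = alg_scale (of_real k)"
  by (simp add: fun_eq_iff real_scale_def alg_scale_def scaleR_conv_of_real)

lemma linear_Rm: "Vector_Spaces.linear real_scale real_scale Rm"
proof -
  have "vector_space real_scale"
    by unfold_locales (auto simp: real_scale_def fun_eq_iff algebra_simps)
  then show ?thesis
    by (simp add: Vector_Spaces.linear_iff Rm_add Rm_scale real_scale_eq)
qed

text \<open>With \<open>p_0^r = - p_0\<close>, matching \<open>r_0 = - u\<close>, the equations (NS6) and (NS7) become the case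
  \<open>\<beta> = 1\<close> of (NS8) and (NS9).\<close>

definition p_r0 :: "aseq \<Rightarrow> nat \<Rightarrow> alg" where
  "p_r0 P \<beta> = (if \<beta> = 0 then - p_zero P else p_r P \<beta>)"

lemma all_nat_iff_shifted:
  fixes Q D :: "nat \<Rightarrow> bool"
  assumes "Q 0 \<longleftrightarrow> R" "\<And>n. n \<ge> 2 \<Longrightarrow> Q (n - 1) \<longleftrightarrow> D n"
  shows "(\<forall>n. Q n) \<longleftrightarrow> R \<and> (\<forall>n\<ge>2. D n)"
proof -
  have "Q n" if "R" "\<forall>n\<ge>2. D n" for n
    using that assms(1) assms(2)[of "Suc n"] by (cases n) auto
  then show ?thesis using assms by blast
qed

lemma r_equations_iff:
  "(\<forall>\<beta>.
       Dx (p_r0 P (Suc \<beta>)) = u_x * Dx (p_r0 P \<beta>) + Dx (r_fun \<beta>) * Dx (p_zero P)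
         - Dy (p_r0 P \<beta>) \<and>
       Dz (p_r0 P (Suc \<beta>)) = u_z * Dx (p_r0 P \<beta>) + Dx (r_fun \<beta>) * Dz (p_zero P)
         - Dt (p_r0 P \<beta>)) \<longleftrightarrow>
     (Dx (p_r P 1) - Dy (p_zero P) + 2 * u_x * Dx (p_zero P) = 0 \<and>
     Dz (p_r P 1) - Dt (p_zero P) + u_x * Dz (p_zero P) + u_z * Dx (p_zero P) = 0) \<and>
     (\<forall>\<beta>\<ge>2.
       Dx (p_r P \<beta>) - u_x * Dx (p_r P (\<beta> - 1)) - Dx (r_fun (\<beta> - 1)) * Dx (p_zero P)
         + Dy (p_r P (\<beta> - 1)) = 0 \<and>
       Dz (p_r P \<beta>) - u_z * Dx (p_r P (\<beta> - 1)) - Dx (r_fun (\<beta> - 1)) * Dz (p_zero P)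
         + Dt (p_r P (\<beta> - 1)) = 0)"
  by (rule all_nat_iff_shifted)
    (simp_all add: p_r0_def r_fun_def[of 0] D_rules D_coord algebra_simps add_eq_0_iff)

text \<open>Each equation is solved for the derivative to be eliminated, so that membership of
  \<open>P\<close> supplies rewrite rules.\<close>

lemma tau_sym_iff:
  "P \<in> tau_sym \<longleftrightarrow>
     Dy (Dz (p_zero P)) = Dt (Dx (p_zero P)) - u_z * Dx (Dx (p_zero P)) + u_x * Dx (Dz (p_zero P))
       - u_xt 2 0 * Dz (p_zero P) + u_xzt 1 1 0 * Dx (p_zero P) \<and>
     (\<forall>\<alpha>.
       Dt (p_q P \<alpha>) = u_z * Dx (p_q P \<alpha>) + Dx (q_var \<alpha> 0 0) * Dz (p_zero P)
         + Dz (prev (p_q P) \<alpha>) \<and>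
       Dy (p_q P \<alpha>) = u_x * Dx (p_q P \<alpha>) + Dx (q_var \<alpha> 0 0) * Dx (p_zero P)
         + Dx (prev (p_q P) \<alpha>) \<and>
       Dt (p_m P \<alpha>) = u_z * Dx (p_m P \<alpha>) + Dx (m_var \<alpha> 0 0) * Dz (p_zero P)
         - z_var * inv_t * Dz (p_m P \<alpha>) - inv_t * Dz (prev (p_m P) \<alpha>) \<and>
       Dy (p_m P \<alpha>) = u_x * Dx (p_m P \<alpha>) + Dx (m_var \<alpha> 0 0) * Dx (p_zero P)
         - z_var * inv_t * Dx (p_m P \<alpha>) - inv_t * Dx (prev (p_m P) \<alpha>)) \<and>
     (\<forall>\<beta>.
       Dx (p_r0 P (Suc \<beta>)) = u_x * Dx (p_r0 P \<beta>) + Dx (r_fun \<beta>) * Dx (p_zero P)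
         - Dy (p_r0 P \<beta>) \<and>
       Dz (p_r0 P (Suc \<beta>)) = u_z * Dx (p_r0 P \<beta>) + Dx (r_fun \<beta>) * Dz (p_zero P)
         - Dt (p_r0 P \<beta>))"
  unfolding tau_sym_def r_equations_iff mem_Collect_eq conj_assoc
  by (intro conj_cong all_cong refl) (simp_all add: algebra_simps)

lemma prev_simps: "prev s 0 = 0" "prev s (Suc n) = s n"
  by (simp_all add: prev_def)

lemma p_zero_Rm: "p_zero (Rm P) = t_var * (u_x * p_zero P + p_r0 P 1) + z_var * p_zero P"
  using make_seq_simps(1) by (simp add: Rm_def Rq_def p_zero_def alg_scale_def p_r0_def)

lemma p_q_Rm: "p_q (Rm P) \<alpha> =
    t_var * (Dx (q_var \<alpha> 0 0) * p_zero P + prev (p_q P) \<alpha>) + z_var * p_q P \<alpha>"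
  using make_seq_simps(2) by (simp add: Rm_def Rq_def p_q_def alg_scale_def)

lemma inv_t_t: "inv_t * (t_var * f) = f"
  using var_inv_var[of CT] by (simp add: mult.assoc[symmetric] mult.commute[of inv_t])

text \<open>The summand \<open>z_var * p_m P \<alpha>\<close> of the scaled identity cancels against
  \<open>t_var\<close> times the last term of the m-component of \<open>Rq P\<close>.\<close>

lemma p_m_Rm: "p_m (Rm P) \<alpha> = t_var * (Dx (m_var \<alpha> 0 0) * p_zero P) - prev (p_m P) \<alpha>"
proof -
  have "p_m (Rm P) \<alpha> = t_var * (Dx (m_var \<alpha> 0 0) * p_zero P - inv_t * prev (p_m P) \<alpha>
      - z_var * inv_t * p_m P \<alpha>) + z_var * p_m P \<alpha>"
    using make_seq_simps(3) by (simp add: Rm_def Rq_def p_m_def alg_scale_def)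
  also have "\<dots> = t_var * (Dx (m_var \<alpha> 0 0) * p_zero P) - prev (p_m P) \<alpha>"
    by (simp add: algebra_simps inv_t_t)
  finally show ?thesis .
qed

lemma p_r0_Rm: "p_r0 (Rm P) \<beta> =
    t_var * (Dx (r_fun \<beta>) * p_zero P - p_r0 P (Suc \<beta>)) + z_var * p_r0 P \<beta>"
proof (cases "\<beta> = 0")
  case True
  then show ?thesis
    using p_zero_Rm[of P] by (simp add: p_r0_def r_fun_def D_rules D_coord algebra_simps)
next
  case False
  then have "p_r (Rm P) \<beta> = t_var * (Dx (r_fun \<beta>) * p_zero P - p_r P (\<beta> + 1)) + z_var * p_r P \<beta>"
    using make_seq_simps(4)[of \<beta>] by (simp add: Rm_def Rq_def p_r_def alg_scale_def)
  then show ?thesis using False by (simp add: p_r0_def)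
qed

text \<open>For equations involving only \<open>Dx\<close> and \<open>Dy\<close>, the factors
  \<open>t_var\<close> and \<open>z_var\<close> act as constants. In the others, the terms produced
  by \<open>Dt t_var = 1\<close> in the multiple of \<open>Rq P\<close> cancel against those
  produced by \<open>Dz z_var = 1\<close> in the multiple of \<open>P\<close>.\<close>

lemma Rm_tau_sym:
  assumes "P \<in> tau_sym" shows "Rm P \<in> tau_sym"
proof -
  define p where "p = p_zero P"
  have NS1: "Dy (Dz p) = Dt (Dx p) - u_z * Dx (Dx p) + u_x * Dz (Dx p)
       - u_xt 2 0 * Dz p + u_xzt 1 1 0 * Dx p"
    and q: "Dt (p_q P \<alpha>) = u_z * Dx (p_q P \<alpha>) + Dx (q_var \<alpha> 0 0) * Dz p + Dz (prev (p_q P) \<alpha>)"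
      "Dy (p_q P \<alpha>) = u_x * Dx (p_q P \<alpha>) + Dx (q_var \<alpha> 0 0) * Dx p + Dx (prev (p_q P) \<alpha>)"
    and m: "Dt (p_m P \<alpha>) = u_z * Dx (p_m P \<alpha>) + Dx (m_var \<alpha> 0 0) * Dz p
         - z_var * inv_t * Dz (p_m P \<alpha>) - inv_t * Dz (prev (p_m P) \<alpha>)"
      "Dy (p_m P \<alpha>) = u_x * Dx (p_m P \<alpha>) + Dx (m_var \<alpha> 0 0) * Dx p
         - z_var * inv_t * Dx (p_m P \<alpha>) - inv_t * Dx (prev (p_m P) \<alpha>)"
    and r: "Dx (p_r0 P (Suc \<beta>)) = u_x * Dx (p_r0 P \<beta>) + Dx (r_fun \<beta>) * Dx p - Dy (p_r0 P \<beta>)"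
      "Dz (p_r0 P (Suc \<beta>)) = u_z * Dx (p_r0 P \<beta>) + Dx (r_fun \<beta>) * Dz p - Dt (p_r0 P \<beta>)"
    for \<alpha> \<beta>
    using assms unfolding tau_sym_iff p_def by (simp_all add: Dx_Dz_commute)
  \<comment> \<open>These are (NS6) and (NS7), needed in every equation because
    \<open>p_zero (Rm P)\<close> contains \<open>p_r0 P 1\<close>.\<close>
  have r1: "Dx (p_r0 P (Suc 0)) = Dy p - 2 * u_x * Dx p"
    "Dz (p_r0 P (Suc 0)) = Dt p - u_x * Dz p - u_z * Dx p"
    using r[of 0] by (simp_all add: p_r0_def p_def r_fun_def D_rules D_coord)
  show ?thesis unfolding tau_sym_iff
  proof (intro conjI allI)
    let ?p = "p_zero (Rm P)"
    show "Dy (Dz ?p) = Dt (Dx ?p) - u_z * Dx (Dx ?p) + u_x * Dx (Dz ?p)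
       - u_xt 2 0 * Dz ?p + u_xzt 1 1 0 * Dx ?p"
      unfolding p_zero_Rm p_def[symmetric]
      \<comment> \<open>The commutation rules are oriented so that \<open>Dt\<close> moves
        outermost, followed by \<open>Dy\<close>, \<open>Dz\<close> and \<open>Dx\<close>. The left
        side \<open>Dy (Dz p)\<close> of \<open>NS1\<close> is in this normal form.\<close>
      by (simp add: D_rules D_coord r1 NS1 G_def numeral_2_eq_2
          Dx_Dy_commute Dx_Dt_commute Dy_Dt_commute Dx_Dz_commute Dy_Dz_commute[symmetric] Dz_Dt_commute algebra_simps)
    fix \<alpha>
    show "Dt (p_q (Rm P) \<alpha>) = u_z * Dx (p_q (Rm P) \<alpha>) + Dx (q_var \<alpha> 0 0) * Dz ?p
         + Dz (prev (p_q (Rm P)) \<alpha>)"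
      by (cases \<alpha>)
        (simp_all add: p_zero_Rm p_q_Rm prev_simps
          p_def[symmetric] D_rules D_coord q r1 algebra_simps)
    show "Dy (p_q (Rm P) \<alpha>) = u_x * Dx (p_q (Rm P) \<alpha>) + Dx (q_var \<alpha> 0 0) * Dx ?p
         + Dx (prev (p_q (Rm P)) \<alpha>)"
      by (cases \<alpha>)
        (simp_all add: p_zero_Rm p_q_Rm prev_simps
          p_def[symmetric] D_rules D_coord q r1 algebra_simps)
    show "Dt (p_m (Rm P) \<alpha>) = u_z * Dx (p_m (Rm P) \<alpha>) + Dx (m_var \<alpha> 0 0) * Dz ?p
         - z_var * inv_t * Dz (p_m (Rm P) \<alpha>) - inv_t * Dz (prev (p_m (Rm P)) \<alpha>)"
      by (cases \<alpha>)
        (simp_all add: p_zero_Rm p_m_Rm prev_simps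
          p_def[symmetric] D_rules D_coord D_inv_t inv_t_t m r1 algebra_simps)
    show "Dy (p_m (Rm P) \<alpha>) = u_x * Dx (p_m (Rm P) \<alpha>) + Dx (m_var \<alpha> 0 0) * Dx ?p
         - z_var * inv_t * Dx (p_m (Rm P) \<alpha>) - inv_t * Dx (prev (p_m (Rm P)) \<alpha>)"
      by (cases \<alpha>)
        (simp_all add: p_zero_Rm p_m_Rm prev_simps
          p_def[symmetric] D_rules D_coord D_inv_t inv_t_t m r1 algebra_simps)
  next
    let ?p = "p_zero (Rm P)"
    fix \<beta>
    \<comment> \<open>Component \<beta> + 1 of \<open>Rm P\<close> contains
      \<open>Dx (r_fun (Suc \<beta>)) * p\<close>; \<open>rx\<close> and \<open>rz\<close> reduce
      the derivatives of its first factor to \<open>r_fun \<beta>\<close>.\<close>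
    have rx: "Dx (Dx (r_fun (Suc \<beta>))) =
        u_xt 2 0 * Dx (r_fun \<beta>) + u_x * Dx (Dx (r_fun \<beta>)) - Dy (Dx (r_fun \<beta>))"
      by (simp add: D_r_fun_Suc D_rules D_coord Dx_Dy_commute numeral_2_eq_2 algebra_simps)
    have rz: "Dz (Dx (r_fun (Suc \<beta>))) =
        u_xzt 1 1 0 * Dx (r_fun \<beta>) + u_z * Dx (Dx (r_fun \<beta>)) - Dt (Dx (r_fun \<beta>))"
      by (subst Dx_Dz_commute[symmetric])
        (simp add: D_r_fun_Suc D_rules D_coord Dx_Dt_commute algebra_simps)
    show "Dx (p_r0 (Rm P) (Suc \<beta>)) = u_x * Dx (p_r0 (Rm P) \<beta>) + Dx (r_fun \<beta>) * Dx ?p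
         - Dy (p_r0 (Rm P) \<beta>)"
      \<comment> \<open>The equation for \<open>P\<close> enters at two indices, since component
        \<beta> + 1 of \<open>Rm P\<close> involves \<open>p_r0 P\<close> at \<beta> + 2 and \<beta>
        + 1.\<close>
      by (simp add: p_zero_Rm p_r0_Rm p_def[symmetric] D_rules D_coord
          rx r(1)[of "Suc \<beta>"] r(1)[of \<beta>] r1 numeral_2_eq_2 algebra_simps)
    show "Dz (p_r0 (Rm P) (Suc \<beta>)) = u_z * Dx (p_r0 (Rm P) \<beta>) + Dx (r_fun \<beta>) * Dz ?p
         - Dt (p_r0 (Rm P) \<beta>)"
      by (simp add: p_zero_Rm p_r0_Rm p_def[symmetric] D_rules D_coord
          rz r(2)[of "Suc \<beta>"] r[of \<beta>] r1 numeral_2_eq_2 algebra_simps)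
  qed
qed

theorem proposition2:
  shows "module_hom alg_scale alg_scale Rm \<and> recursion_operator Rm"
  using module_hom_Rm linear_Rm Rm_tau_sym by (auto simp: recursion_operator_def)

end
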